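(* Let $(p_n)$ be a sequence of positive integers diverging to $\infty$ as $n\to\infty$. Assume that the sequence $(\mathrm{P}^{(n)}_{F_n})$ is such that, as $n\to\infty$, (i) $\min\Big(\frac{p_n\tilde e_{n2}^2}{f_{n2}^2},\frac{\tilde e_{n2}}{ne_{n1}^2}\Big)=o(1)$, (ii) $\tilde e_{n4}/\tilde e_{n2}^2=o(n)$, and (iii) $f_{n4}/f_{n2}^2=o(n)$. Then, under $\mathrm{P}^{(n)}_{F_n}$, $$ \frac{R_n^{\rm St}-\mathrm{E}[R_n^{\rm St}]}{\sigma_n}=\frac{\sqrt{2p_n}}{n\sigma_n}\sum_{1\le i<j\le n}\big(X_{ni}'X_{nj}-e_{n1}^2\big)\stackrel{\mathcal D}{\to}\mathcal{N}(0,1) $$ as $n\to\infty$, where $\sigma_n^2:=p_n\tilde e_{n2}^2+2np_ne_{n1}^2\tilde e_{n2}+f_{n2}^2$.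
   Context: $\mathcal{S}^{p-1}=\{x\in\mathbb{R}^p:\|x\|=1\}$. A random vector $X$ on $\mathcal{S}^{p-1}$ is rotationally symmetric about $\theta\in\mathcal{S}^{p-1}$ if $OX$ is equal in distribution to $X$ for any orthogonal $p\times p$ matrix $O$ with $O\theta=\theta$. $\mathrm{P}^{(n)}_{F_n}$ denotes the hypothesis under which $X_{n1},\ldots,X_{nn}$ are i.i.d. on $\mathcal{S}^{p_n-1}$ with a common distribution that is rotationally symmetric about $\theta_n$, where $\theta_n$ is the first vector of the canonical basis of $\mathbb{R}^{p_n}$, and such that $X_{ni}'\theta_n$ has cumulative distribution function $F_n$ (no absolute continuity is assumed). Under $\mathrm{P}^{(n)}_{F_n}$, put $e_{n\ell}:=\mathrm{E}[(X_{ni}'\theta_n)^\ell]$, $\tilde e_{n\ell}:=\mathrm{E}[(X_{ni}'\theta_n-e_{n1})^\ell]$, $f_{n\ell}:=\mathrm{E}[(1-(X_{ni}'\theta_n)^2)^{\ell/2}]$. A ratio with positive numerator and zero denominator (e.g. $\tilde e_{n2}/(ne_{n1}^2)$ when $e_{n1}=0$) is read as $+\infty$. The standardized Rayleigh statistic is $R_n^{\rm St}:=\frac{np_n\|\bar X_n\|^2-p_n}{\sqrt{2p_n}}=\frac{\sqrt{2p_n}}{n}\sum_{1\le i<j\le n}X_{ni}'X_{nj}$, with $\bar X_n:=\frac1n\sum_{i=1}^nX_{ni}$. *)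

theory Defs
  imports "HOL-Probability.Probability" "HOL-Library.Landau_Symbols"
begin

text \<open>
  The dimension varies with the sample size, so a vector of \<open>\<real>\<^sup>p\<close> is an (extensional) function on
  \<open>{..<p}\<close>.  Coordinates are numbered from 0, observations from 1.
\<close>

definition vec_borel :: "nat \<Rightarrow> (nat \<Rightarrow> real) measure" where
  "vec_borel p = (\<Pi>\<^sub>M j\<in>{..<p}. borel)"

definition vec_inner :: "nat \<Rightarrow> (nat \<Rightarrow> real) \<Rightarrow> (nat \<Rightarrow> real) \<Rightarrow> real" where
  "vec_inner p x y = (\<Sum>j<p. x j * y j)"

definition vec_norm :: "nat \<Rightarrow> (nat \<Rightarrow> real) \<Rightarrow> real" where
  "vec_norm p x = L2_set x {..<p}"

definition unit_sphere :: "nat \<Rightarrow> (nat \<Rightarrow> real) set" where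
  "unit_sphere p = {x \<in> space (vec_borel p). vec_norm p x = 1}"

definition canonical_vec :: "nat \<Rightarrow> nat \<Rightarrow> (nat \<Rightarrow> real)" where
  "canonical_vec p k = (\<lambda>j\<in>{..<p}. if j = k then 1 else 0)"

definition mat_vec :: "nat \<Rightarrow> (nat \<Rightarrow> nat \<Rightarrow> real) \<Rightarrow> (nat \<Rightarrow> real) \<Rightarrow> (nat \<Rightarrow> real)" where
  "mat_vec p A x = (\<lambda>i\<in>{..<p}. \<Sum>j<p. A i j * x j)"

definition orthogonal_mat :: "nat \<Rightarrow> (nat \<Rightarrow> nat \<Rightarrow> real) \<Rightarrow> bool" where
  "orthogonal_mat p A \<longleftrightarrow>
    (\<forall>i<p. \<forall>j<p. (\<Sum>k<p. A k i * A k j) = (if i = j then 1 else 0)) \<and>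
    (\<forall>i<p. \<forall>j<p. (\<Sum>k<p. A i k * A j k) = (if i = j then 1 else 0))"

definition rotationally_symmetric ::
  "'a measure \<Rightarrow> nat \<Rightarrow> (nat \<Rightarrow> real) \<Rightarrow> ('a \<Rightarrow> nat \<Rightarrow> real) \<Rightarrow> bool" where
  "rotationally_symmetric M p \<theta> Y \<longleftrightarrow>
    (\<forall>A. orthogonal_mat p A \<and> mat_vec p A \<theta> = \<theta> \<longrightarrow>
      distr M (vec_borel p) (\<lambda>\<omega>. mat_vec p A (Y \<omega>)) = distr M (vec_borel p) Y)"

text \<open>
  The hypothesis \<open>P\<^sub>F\<close> for a sample \<open>X 1, \<dots>, X n\<close>; the location \<open>\<theta>\<close> is the first canonical vector.
\<close>

definition rotsym_hypothesis ::
  "'a measure \<Rightarrow> nat \<Rightarrow> nat \<Rightarrow> (real \<Rightarrow> real) \<Rightarrow> (nat \<Rightarrow> 'a \<Rightarrow> nat \<Rightarrow> real) \<Rightarrow> bool" where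
  "rotsym_hypothesis M n p F X \<longleftrightarrow>
    prob_space M \<and>
    prob_space.indep_vars M (\<lambda>_. vec_borel p) X {1..n} \<and>
    (\<forall>i\<in>{1..n}. \<forall>j\<in>{1..n}. distr M (vec_borel p) (X i) = distr M (vec_borel p) (X j)) \<and>
    (\<forall>i\<in>{1..n}. X i \<in> space M \<rightarrow> unit_sphere p \<and>
      rotationally_symmetric M p (canonical_vec p 0) (X i) \<and>
      cdf (distr M borel (\<lambda>\<omega>. vec_inner p (X i \<omega>) (canonical_vec p 0))) = F)"

text \<open>
  The moments \<open>e\<^sub>\<ell>\<close>, \<open>e\<^sub>\<ell>\<close> with tilde (centred), \<open>f\<^sub>\<ell>\<close> of one observation \<open>Y\<close>.
  For sphere-valued \<open>Y\<close> the argument of the square root is nonnegative, so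
  \<open>sqrt t ^ \<ell>\<close> is \<open>t\<close> to the power \<open>\<ell> / 2\<close>, including \<open>\<ell> = 0\<close>.
\<close>

definition e_mom :: "'a measure \<Rightarrow> nat \<Rightarrow> ('a \<Rightarrow> nat \<Rightarrow> real) \<Rightarrow> nat \<Rightarrow> real" where
  "e_mom M p Y l = (\<integral>\<omega>. vec_inner p (Y \<omega>) (canonical_vec p 0) ^ l \<partial>M)"

definition e_cmom :: "'a measure \<Rightarrow> nat \<Rightarrow> ('a \<Rightarrow> nat \<Rightarrow> real) \<Rightarrow> nat \<Rightarrow> real" where
  "e_cmom M p Y l = (\<integral>\<omega>. (vec_inner p (Y \<omega>) (canonical_vec p 0) - e_mom M p Y 1) ^ l \<partial>M)"

definition f_mom :: "'a measure \<Rightarrow> nat \<Rightarrow> ('a \<Rightarrow> nat \<Rightarrow> real) \<Rightarrow> nat \<Rightarrow> real" where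
  "f_mom M p Y l = (\<integral>\<omega>. sqrt (1 - (vec_inner p (Y \<omega>) (canonical_vec p 0))\<^sup>2) ^ l \<partial>M)"

definition sigma_n :: "'a measure \<Rightarrow> nat \<Rightarrow> nat \<Rightarrow> ('a \<Rightarrow> nat \<Rightarrow> real) \<Rightarrow> real" where
  "sigma_n M n p Y = sqrt (real p * (e_cmom M p Y 2)\<^sup>2
     + 2 * real n * real p * (e_mom M p Y 1)\<^sup>2 * e_cmom M p Y 2 + (f_mom M p Y 2)\<^sup>2)"

definition sample_mean :: "nat \<Rightarrow> nat \<Rightarrow> (nat \<Rightarrow> nat \<Rightarrow> real) \<Rightarrow> (nat \<Rightarrow> real)" where
  "sample_mean n p x = (\<lambda>k\<in>{..<p}. (\<Sum>i=1..n. x i k) / real n)"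

definition rayleigh_st :: "nat \<Rightarrow> nat \<Rightarrow> (nat \<Rightarrow> 'a \<Rightarrow> nat \<Rightarrow> real) \<Rightarrow> 'a \<Rightarrow> real" where
  "rayleigh_st n p X \<omega> =
    (real n * real p * (vec_norm p (sample_mean n p (\<lambda>i. X i \<omega>)))\<^sup>2 - real p) / sqrt (2 * real p)"

end

theory Submission
  imports Defs
begin

text \<open>
  Split \<open>X\<^sub>i\<close> into its first coordinate, with centred version \<open>Z\<^sub>i\<close>, and the orthogonal part \<open>W\<^sub>i\<close>.  Then
  \<open>X\<^sub>i \<bullet> X\<^sub>j - e\<^sub>1\<^sup>2 = Z\<^sub>i Z\<^sub>j + e\<^sub>1 (Z\<^sub>i + Z\<^sub>j) + W\<^sub>i \<bullet> W\<^sub>j\<close>.  Condition (i) makes the sum of the terms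
  \<open>Z\<^sub>i Z\<^sub>j\<close> negligible in \<open>L\<^sup>2\<close>: whichever ratio attains the minimum, the corresponding one of the two
  other sums dominates it.  What remains is a sum of martingale differences
  \<open>D\<^sub>j = (n - 1) e\<^sub>1 Z\<^sub>j + W\<^sub>j \<bullet> T\<close> with \<open>T = W\<^sub>1 + \<dots> + W\<^bsub>j-1\<^esub>\<close>.  By rotational symmetry, given the past, the pair
  \<open>(Z\<^sub>j, W\<^sub>j \<bullet> T)\<close> is distributed as \<open>Z\<^sub>j\<close> together with \<open>\<bar>T\<bar>\<close> times one coordinate of \<open>W\<^sub>j\<close>; hence the conditional
  variance is affine in \<open>\<bar>T\<bar>\<^sup>2\<close>, whose fluctuations are small by (iii) and \<open>p\<^sub>n \<rightarrow> \<infinity>\<close>, and the fourth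
  moments of the differences are small by (ii) and (iii).  The characteristic function of the sum
  is compared with the Gaussian one step by step, and Levy's continuity theorem concludes.
\<close>

section \<open>Characteristic functions of sums of martingale differences\<close>

text \<open>The delicate point is to condition on the past. Conditional expectations are never
  formed: a statement given the past is an identity of expectations against every bounded
  past-measurable test function \<open>G\<close>, obtained from Fubini for the pair of past and next
  observation. In the end \<open>G\<close> is \<open>iexp (t * mart s c j \<omega>)\<close>, hence
  the Banach-valued generality.

  The law of the direction of \<open>W\<close> is never identified. Reflections fixing \<theta> move
  every unit vector orthogonal to \<theta> to a fixed one, and this alone yields the moments of a
  coordinate of \<open>W\<close>, with no surface measure.

  All estimates are explicit for a fixed n. Divided by \<open>\<sigma>\<^sup>2\<close>, the three
  summands of \<open>\<sigma>\<^sup>2\<close> become weights with sum 1, belonging to the products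
  \<open>Z\<^sub>i Z\<^sub>j\<close>, the linear part and the orthogonal part. The weight of the
  products bounds both their second moment and, up to vanishing terms, the variance missing from the
  martingale. Since (i) bounds this weight index by index, the attaining ratio may change with n
  without any passage to subsequences. Eventual positivity of \<open>sigma_n\<close> excludes the
  degenerate quotient, which is 0 in HOL.\<close>

lemma exp_minus_le_quadratic:
  fixes a :: real
  assumes "0 \<le> a"
  shows "\<bar>exp (- a) - 1 + a\<bar> \<le> a\<^sup>2 / 2"
proof -
  have lower: "1 - a \<le> exp (- a)"
    using exp_ge_add_one_self[of "- a"] by simp
  have "0 < 1 + a + a\<^sup>2 / 2"
    using assms by (simp add: add_pos_nonneg)
  moreover have "1 + a + a\<^sup>2 / 2 \<le> exp a"
    using exp_lower_Taylor_quadratic[OF assms] .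
  ultimately have "exp (- a) \<le> 1 / (1 + a + a\<^sup>2 / 2)"
    by (simp add: exp_minus inverse_eq_divide frac_le)
  also have "\<dots> \<le> 1 - a + a\<^sup>2 / 2"
  proof -
    have "(1 - a + a\<^sup>2 / 2) * (1 + a + a\<^sup>2 / 2) = 1 + (a\<^sup>2)\<^sup>2 / 4"
      by (simp add: field_simps power2_eq_square)
    then show ?thesis
      using \<open>0 < 1 + a + a\<^sup>2 / 2\<close> by (simp add: pos_divide_le_eq)
  qed
  finally show ?thesis
    using lower by simp
qed

text \<open>Expand the nonnegative quantity
  \<open>x\<^sup>2 * (r - \<bar>x\<bar>)\<^sup>2 / r\<close>. The free weight \<open>r\<close> lets
  a third absolute moment be traded against the second and fourth ones; it is tuned only when n
  tends to infinity.\<close>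

lemma abs_cube_le_weighted:
  fixes x r :: real
  assumes "0 < r"
  shows "\<bar>x\<bar> ^ 3 \<le> (r * x\<^sup>2 + x ^ 4 / r) / 2"
proof -
  have "0 \<le> x\<^sup>2 * (r - \<bar>x\<bar>)\<^sup>2 / r"
    using assms by simp
  also have "\<dots> = r * x\<^sup>2 + x ^ 4 / r - 2 * \<bar>x\<bar> ^ 3"
  proof -
    have "x\<^sup>2 = \<bar>x\<bar>\<^sup>2" "x ^ 4 = \<bar>x\<bar> ^ 4" by simp_all
    then show ?thesis
      using assms by (simp only:) (simp add: field_simps power2_eq_square power3_eq_cube power4_eq_xxxx)
  qed
  finally show ?thesis by simp
qed

lemma power4_sum_le:
  fixes x y :: real
  shows "(x + y) ^ 4 \<le> 8 * (x ^ 4 + y ^ 4)"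
proof -
  have sq: "(a + b)\<^sup>2 \<le> 2 * (a\<^sup>2 + b\<^sup>2)" for a b :: real
    using sum_squares_bound[of a b] by (simp add: power2_sum)
  have "((x + y)\<^sup>2)\<^sup>2 \<le> (2 * (x\<^sup>2 + y\<^sup>2))\<^sup>2"
    using sq by (rule power_mono) simp
  also have "\<dots> = 4 * (x\<^sup>2 + y\<^sup>2)\<^sup>2"
    by (simp only: power_mult_distrib) simp
  also have "\<dots> \<le> 4 * (2 * ((x\<^sup>2)\<^sup>2 + (y\<^sup>2)\<^sup>2))"
    by (intro mult_left_mono sq) simp
  finally show ?thesis
    by (simp flip: power_mult)
qed

lemma vec_inner_canonical_vec:
  "0 < p \<Longrightarrow> vec_inner p x (canonical_vec p 0) = x 0"
  by (simp add: vec_inner_def canonical_vec_def mult_delta_right)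

lemma borel_measurable_vec_component [measurable]:
  "k < p \<Longrightarrow> (\<lambda>x. x k) \<in> borel_measurable (vec_borel p)"
  by (simp add: vec_borel_def)

section \<open>Bounded random variables and one step of the comparison with the Gaussian\<close>

context prob_space
begin

text \<open>Observations lie on the unit sphere, so every variable in the argument is bounded for
  fixed n. Closure rules for boundedness therefore settle all questions of integrability.\<close>

definition bounded_rv :: "('a \<Rightarrow> 'b::real_normed_vector) \<Rightarrow> bool" where
  "bounded_rv f \<longleftrightarrow> f \<in> borel_measurable M \<and> (\<exists>B. \<forall>\<omega>\<in>space M. norm (f \<omega>) \<le> B)"

named_theorems bounded_rv_intros

lemma bounded_rvI:
  "f \<in> borel_measurable M \<Longrightarrow> (\<And>\<omega>. \<omega> \<in> space M \<Longrightarrow> norm (f \<omega>) \<le> B) \<Longrightarrow> bounded_rv f"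
  by (auto simp: bounded_rv_def)

lemma bounded_rv_measurable: "bounded_rv f \<Longrightarrow> f \<in> borel_measurable M"
  by (simp add: bounded_rv_def)

lemma bounded_rv_integrable:
  fixes f :: "'a \<Rightarrow> 'b::{banach, second_countable_topology}"
  assumes "bounded_rv f"
  shows "integrable M f"
  using assms unfolding bounded_rv_def by (auto intro!: integrable_const_bound)

lemma bounded_rv_const [bounded_rv_intros]: "bounded_rv (\<lambda>_. c)"
  by (auto simp: bounded_rv_def)

lemma bounded_rv_add [bounded_rv_intros]:
  fixes f g :: "'a \<Rightarrow> 'b::{real_normed_vector, second_countable_topology}"
  assumes "bounded_rv f" "bounded_rv g"
  shows "bounded_rv (\<lambda>\<omega>. f \<omega> + g \<omega>)"
proof -
  obtain A B where A: "\<And>\<omega>. \<omega> \<in> space M \<Longrightarrow> norm (f \<omega>) \<le> A" and B: "\<And>\<omega>. \<omega> \<in> space M \<Longrightarrow> norm (g \<omega>) \<le> B"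
    using assms unfolding bounded_rv_def by auto
  show ?thesis
    using assms by (intro bounded_rvI[of _ "A + B"] norm_triangle_mono A B)
      (auto simp: bounded_rv_def)
qed

lemma bounded_rv_scaleR [bounded_rv_intros]:
  fixes g :: "'a \<Rightarrow> 'b::{real_normed_vector, second_countable_topology}"
  assumes "bounded_rv f" "bounded_rv g"
  shows "bounded_rv (\<lambda>\<omega>. f \<omega> *\<^sub>R g \<omega>)"
proof -
  obtain A B where A: "\<And>\<omega>. \<omega> \<in> space M \<Longrightarrow> norm (f \<omega>) \<le> A" and B: "\<And>\<omega>. \<omega> \<in> space M \<Longrightarrow> norm (g \<omega>) \<le> B"
    using assms unfolding bounded_rv_def by blast
  have "norm (f \<omega> *\<^sub>R g \<omega>) \<le> A * B" if "\<omega> \<in> space M" for \<omega>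
  proof -
    have "\<bar>f \<omega>\<bar> * norm (g \<omega>) \<le> A * B"
      using A[OF that] B[OF that] by (intro mult_mono) (auto intro: order_trans[OF abs_ge_zero])
    then show ?thesis by simp
  qed
  then show ?thesis
    using assms by (intro bounded_rvI[of _ "A * B"]) (auto simp: bounded_rv_def)
qed

lemma bounded_rv_mult [bounded_rv_intros]:
  fixes f g :: "'a \<Rightarrow> 'b::{real_normed_algebra, second_countable_topology}"
  assumes "bounded_rv f" "bounded_rv g"
  shows "bounded_rv (\<lambda>\<omega>. f \<omega> * g \<omega>)"
proof -
  obtain A B where A: "\<And>\<omega>. \<omega> \<in> space M \<Longrightarrow> norm (f \<omega>) \<le> A" and B: "\<And>\<omega>. \<omega> \<in> space M \<Longrightarrow> norm (g \<omega>) \<le> B"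
    using assms unfolding bounded_rv_def by blast
  have "norm (f \<omega> * g \<omega>) \<le> A * B" if "\<omega> \<in> space M" for \<omega>
    using norm_mult_ineq[of "f \<omega>" "g \<omega>"] A[OF that] B[OF that]
    by (smt (verit) mult_mono norm_ge_zero)
  then show ?thesis
    using assms by (intro bounded_rvI[of _ "A * B"]) (auto simp: bounded_rv_def)
qed

lemma bounded_rv_diff [bounded_rv_intros]:
  fixes f g :: "'a \<Rightarrow> 'b::{real_normed_vector, second_countable_topology}"
  assumes "bounded_rv f" "bounded_rv g"
  shows "bounded_rv (\<lambda>\<omega>. f \<omega> - g \<omega>)"
  using bounded_rv_add[OF assms(1) bounded_rv_scaleR[OF bounded_rv_const[of "-1"] assms(2)]] by simp

lemma bounded_rv_sum [bounded_rv_intros]: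
  fixes f :: "'i \<Rightarrow> 'a \<Rightarrow> 'b::{real_normed_vector, second_countable_topology}"
  assumes "\<And>i. i \<in> I \<Longrightarrow> bounded_rv (f i)"
  shows "bounded_rv (\<lambda>\<omega>. \<Sum>i\<in>I. f i \<omega>)"
  using assms by (induction I rule: infinite_finite_induct) (auto intro!: bounded_rv_intros)

lemma bounded_rv_power [bounded_rv_intros]:
  fixes f :: "'a \<Rightarrow> 'b::{real_normed_algebra_1, second_countable_topology}"
  assumes "bounded_rv f"
  shows "bounded_rv (\<lambda>\<omega>. f \<omega> ^ k)"
  using assms by (induction k) (auto intro!: bounded_rv_intros)

lemma bounded_rv_divide [bounded_rv_intros]:
  fixes f :: "'a \<Rightarrow> real"
  shows "bounded_rv f \<Longrightarrow> bounded_rv (\<lambda>\<omega>. f \<omega> / c)"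
  using bounded_rv_mult[OF _ bounded_rv_const[of "inverse c"]] by (simp add: divide_inverse)

lemma bounded_rv_abs [bounded_rv_intros]:
  fixes f :: "'a \<Rightarrow> real"
  shows "bounded_rv f \<Longrightarrow> bounded_rv (\<lambda>\<omega>. \<bar>f \<omega>\<bar>)"
  by (auto simp: bounded_rv_def)

lemma bounded_rv_sqrt [bounded_rv_intros]:
  assumes "bounded_rv f"
  shows "bounded_rv (\<lambda>\<omega>. sqrt (f \<omega>))"
proof -
  obtain B where "\<And>\<omega>. \<omega> \<in> space M \<Longrightarrow> \<bar>f \<omega>\<bar> \<le> B"
    using assms unfolding bounded_rv_def by auto
  \<comment> \<open>In HOL \<open>sqrt\<close> is extended to negative numbers as an odd function,
    so \<open>\<bar>sqrt x\<bar> = sqrt \<bar>x\<bar>\<close> holds without a sign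
    condition.\<close>
  then show ?thesis
    using assms by (intro bounded_rvI[of _ "sqrt B"])
      (auto simp: bounded_rv_def sqrt_def real_root_abs[symmetric])
qed

lemma bounded_rv_of_real [bounded_rv_intros]:
  "bounded_rv f \<Longrightarrow> bounded_rv (\<lambda>\<omega>. complex_of_real (f \<omega>))"
  by (auto simp: bounded_rv_def)

lemma bounded_rv_iexp [bounded_rv_intros]:
  "bounded_rv f \<Longrightarrow> bounded_rv (\<lambda>\<omega>. iexp (f \<omega>))"
  by (auto simp: bounded_rv_def intro!: exI[of _ 1])

lemma expectation_power2_le:
  fixes f :: "'a \<Rightarrow> real"
  assumes "bounded_rv f"
  shows "(expectation f)\<^sup>2 \<le> expectation (\<lambda>\<omega>. (f \<omega>)\<^sup>2)"
proof -
  have "0 \<le> variance f"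
    by simp
  then show ?thesis
    using assms by (subst (asm) variance_eq) (auto intro!: bounded_rv_integrable bounded_rv_intros)
qed

lemma expectation_abs_le:
  fixes f :: "'a \<Rightarrow> real"
  assumes "bounded_rv f"
  shows "expectation (\<lambda>\<omega>. \<bar>f \<omega>\<bar>) \<le> sqrt (expectation (\<lambda>\<omega>. (f \<omega>)\<^sup>2))"
proof -
  have "(expectation (\<lambda>\<omega>. \<bar>f \<omega>\<bar>))\<^sup>2 \<le> expectation (\<lambda>\<omega>. \<bar>f \<omega>\<bar>\<^sup>2)"
    using assms by (intro expectation_power2_le bounded_rv_intros)
  then show ?thesis
    by (intro real_le_rsqrt) simp
qed

text \<open>From \<open>cmod (iexp a - 1) \<le> \<bar>a\<bar>\<close> and the second-moment bound
  for the first absolute moment. It is what allows a summand that is small in mean square to be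
  discarded at the level of characteristic functions.\<close>

lemma char_perturbation:
  assumes "bounded_rv S" "bounded_rv A"
  shows "cmod ((CLINT \<omega>|M. iexp (t * (S \<omega> + A \<omega>))) - (CLINT \<omega>|M. iexp (t * S \<omega>)))
    \<le> \<bar>t\<bar> * sqrt (expectation (\<lambda>\<omega>. (A \<omega>)\<^sup>2))"
proof -
  have "(CLINT \<omega>|M. iexp (t * (S \<omega> + A \<omega>))) - (CLINT \<omega>|M. iexp (t * S \<omega>))
      = (CLINT \<omega>|M. iexp (t * (S \<omega> + A \<omega>)) - iexp (t * S \<omega>))"
    using assms by (intro Bochner_Integration.integral_diff[symmetric] bounded_rv_integrable bounded_rv_intros)
  also have "cmod \<dots> \<le> (LINT \<omega>|M. cmod (iexp (t * (S \<omega> + A \<omega>)) - iexp (t * S \<omega>)))"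
    by (rule integral_norm_bound)
  also have "\<dots> \<le> (LINT \<omega>|M. \<bar>t\<bar> * \<bar>A \<omega>\<bar>)"
  proof (intro integral_mono)
    fix \<omega>
    have "iexp (t * (S \<omega> + A \<omega>)) - iexp (t * S \<omega>) = iexp (t * S \<omega>) * (iexp (t * A \<omega>) - 1)"
      by (simp add: algebra_simps exp_add)
    also have "cmod \<dots> = cmod (iexp (t * A \<omega>) - 1)"
      by (simp add: norm_mult)
    also have "\<dots> \<le> \<bar>t * A \<omega>\<bar>"
      using iexp_approx1[of "t * A \<omega>" 0] by simp
    finally show "cmod (iexp (t * (S \<omega> + A \<omega>)) - iexp (t * S \<omega>)) \<le> \<bar>t\<bar> * \<bar>A \<omega>\<bar>"
      by (simp add: abs_mult)
  qed (use assms in \<open>auto intro!: bounded_rv_integrable integrable_norm bounded_rv_intros simp del: of_real_add of_real_mult\<close>)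
  also have "\<dots> \<le> \<bar>t\<bar> * sqrt (expectation (\<lambda>\<omega>. (A \<omega>)\<^sup>2))"
    using expectation_abs_le[OF assms(2)] by (simp add: mult_left_mono)
  finally show ?thesis .
qed

text \<open>
  One step of the martingale central limit theorem: \<open>D\<close> is a martingale difference after \<open>S\<close> with
  conditional variance \<open>V\<close>.  Comparing \<open>V\<close> with a deterministic \<open>s\<close> keeps the factors
  \<open>exp (- t\<^sup>2 * s / 2)\<close> bounded, so that no truncation of the conditional variances is needed.
\<close>

lemma char_martingale_step:
  assumes b: "bounded_rv S" "bounded_rv D" "bounded_rv V"
    and mean: "(CLINT \<omega>|M. iexp (t * S \<omega>) * D \<omega>) = 0"
    and var: "(CLINT \<omega>|M. iexp (t * S \<omega>) * (D \<omega>)\<^sup>2) = (CLINT \<omega>|M. iexp (t * S \<omega>) * V \<omega>)"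
    and s: "0 \<le> s"
  shows "cmod ((CLINT \<omega>|M. iexp (t * (S \<omega> + D \<omega>))) - complex_of_real (exp (- (t\<^sup>2 * s / 2))) * (CLINT \<omega>|M. iexp (t * S \<omega>)))
    \<le> \<bar>t\<bar> ^ 3 / 6 * expectation (\<lambda>\<omega>. \<bar>D \<omega>\<bar> ^ 3) + t\<^sup>2 / 2 * expectation (\<lambda>\<omega>. \<bar>V \<omega> - s\<bar>) + t ^ 4 / 8 * s\<^sup>2"
proof -
  define a where "a = t\<^sup>2 * s / 2"
  have "0 \<le> a"
    using s by (simp add: a_def)
  define E where "E \<omega> = iexp (t * S \<omega>)" for \<omega>
  define R where "R \<omega> = iexp (t * D \<omega>) - (1 + \<i> * (t * D \<omega>) - (t * D \<omega>)\<^sup>2 / 2)" for \<omega>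
  define c where "c = exp (- a) - 1 + a"
  have bE [bounded_rv_intros]: "bounded_rv E"
    unfolding E_def using b by (intro bounded_rv_intros)
  have bR [bounded_rv_intros]: "bounded_rv R"
  proof -
    have "bounded_rv (\<lambda>\<omega>. iexp (t * D \<omega>) - (1 + \<i> * complex_of_real (t * D \<omega>) - complex_of_real ((t * D \<omega>)\<^sup>2 / 2)))"
      using b by (intro bounded_rv_intros)
    then show ?thesis by (simp add: R_def[abs_def])
  qed
  have E_norm: "cmod (E \<omega>) = 1" for \<omega>
    by (simp add: E_def)
  have R_norm: "cmod (R \<omega>) \<le> \<bar>t\<bar> ^ 3 / 6 * \<bar>D \<omega>\<bar> ^ 3" for \<omega>
  proof -
    have "R \<omega> = iexp (t * D \<omega>) - (\<Sum>k\<le>2. (\<i> * (t * D \<omega>)) ^ k / fact k)"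
    proof -
      have "(\<Sum>k\<le>2. f k) = f 0 + f 1 + f 2" for f :: "nat \<Rightarrow> complex"
        by (simp add: numeral_2_eq_2)
      then show ?thesis
        by (simp add: R_def power_mult_distrib)
    qed
    also have "cmod \<dots> \<le> \<bar>t * D \<omega>\<bar> ^ 3 / 6"
      using iexp_approx1[of "t * D \<omega>" 2] by (simp add: fact_numeral numeral_3_eq_3 numeral_2_eq_2)
    finally show ?thesis
      by (simp add: abs_mult power_mult_distrib)
  qed
  note integrable = bounded_rv_integrable bounded_rv_intros b
  \<comment> \<open>Both exponentials are expanded: \<open>R\<close> is the second-order Taylor
    remainder of \<open>iexp (t * D \<omega>)\<close>, and \<open>c\<close> is the remainder in
    \<open>exp (- a) = 1 - a + c\<close>. The constants 1 cancel.\<close>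
  have decomp: "iexp (t * (S \<omega> + D \<omega>)) - exp (- a) * E \<omega>
      = E \<omega> * R \<omega> + \<i> * t * (E \<omega> * D \<omega>) - t\<^sup>2 / 2 * (E \<omega> * (D \<omega>)\<^sup>2) + (a - c) * E \<omega>" for \<omega>
  proof -
    have "iexp (t * (S \<omega> + D \<omega>)) = E \<omega> * iexp (t * D \<omega>)"
      by (simp add: E_def algebra_simps exp_add)
    then show ?thesis
      by (simp add: R_def c_def algebra_simps power_mult_distrib)
  qed
  have "(CLINT \<omega>|M. iexp (t * (S \<omega> + D \<omega>))) - exp (- a) * (CLINT \<omega>|M. E \<omega>)
      = (CLINT \<omega>|M. iexp (t * (S \<omega> + D \<omega>)) - exp (- a) * E \<omega>)"
    by (subst Bochner_Integration.integral_diff) (auto intro!: integrable simp del: of_real_add of_real_mult)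
  also have "\<dots> = (CLINT \<omega>|M. E \<omega> * R \<omega> + \<i> * t * (E \<omega> * D \<omega>) - t\<^sup>2 / 2 * (E \<omega> * complex_of_real ((D \<omega>)\<^sup>2)) + (a - c) * E \<omega>)"
    by (simp only: decomp of_real_power)
  also have "\<dots> = (CLINT \<omega>|M. E \<omega> * R \<omega>) + \<i> * t * (CLINT \<omega>|M. E \<omega> * D \<omega>)
      - t\<^sup>2 / 2 * (CLINT \<omega>|M. E \<omega> * complex_of_real ((D \<omega>)\<^sup>2)) + (a - c) * (CLINT \<omega>|M. E \<omega>)"
    by (subst Bochner_Integration.integral_add Bochner_Integration.integral_diff, (intro integrable)+)+ simp
  \<comment> \<open>This is where the martingale property acts: the linear term integrates to zero,
    and the square of \<open>D\<close> may be replaced by \<open>V\<close>. The remaining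
    second-order term then pairs with \<open>a\<close> into a multiple of
    \<open>V - s\<close>.\<close>
  also have "\<dots> = (CLINT \<omega>|M. E \<omega> * R \<omega>) - t\<^sup>2 / 2 * (CLINT \<omega>|M. E \<omega> * complex_of_real (V \<omega>)) + (a - c) * (CLINT \<omega>|M. E \<omega>)"
    using mean var by (simp add: E_def[abs_def])
  also have "\<dots> = (CLINT \<omega>|M. E \<omega> * R \<omega> - t\<^sup>2 / 2 * (E \<omega> * complex_of_real (V \<omega>)) + (a - c) * E \<omega>)"
    by (subst Bochner_Integration.integral_add Bochner_Integration.integral_diff, (intro integrable)+)+ simp
  also have "cmod \<dots> \<le> (LINT \<omega>|M. cmod (E \<omega> * R \<omega> - t\<^sup>2 / 2 * (E \<omega> * complex_of_real (V \<omega>)) + (a - c) * E \<omega>))"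
    by (rule integral_norm_bound)
  also have "\<dots> \<le> (LINT \<omega>|M. \<bar>t\<bar> ^ 3 / 6 * \<bar>D \<omega>\<bar> ^ 3 + t\<^sup>2 / 2 * \<bar>V \<omega> - s\<bar> + t ^ 4 / 8 * s\<^sup>2)"
  proof (intro integral_mono)
    show "integrable M (\<lambda>\<omega>. cmod (E \<omega> * R \<omega> - t\<^sup>2 / 2 * (E \<omega> * complex_of_real (V \<omega>)) + (a - c) * E \<omega>))"
      by (intro integrable_norm integrable)
    show "integrable M (\<lambda>\<omega>. \<bar>t\<bar> ^ 3 / 6 * \<bar>D \<omega>\<bar> ^ 3 + t\<^sup>2 / 2 * \<bar>V \<omega> - s\<bar> + t ^ 4 / 8 * s\<^sup>2)"
      by (intro integrable)
    fix \<omega>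
    have "E \<omega> * R \<omega> - t\<^sup>2 / 2 * (E \<omega> * complex_of_real (V \<omega>)) + (a - c) * E \<omega>
        = E \<omega> * (R \<omega> + complex_of_real (- (t\<^sup>2 / 2 * (V \<omega> - s)) - c))"
      by (simp add: a_def algebra_simps diff_divide_distrib)
    also have "cmod \<dots> = cmod (R \<omega> + complex_of_real (- (t\<^sup>2 / 2 * (V \<omega> - s)) - c))"
      by (simp add: norm_mult E_norm)
    also have "\<dots> \<le> cmod (R \<omega>) + \<bar>- (t\<^sup>2 / 2 * (V \<omega> - s)) - c\<bar>"
      by (metis norm_triangle_ineq norm_of_real)
    also have "\<bar>- (t\<^sup>2 / 2 * (V \<omega> - s)) - c\<bar> \<le> \<bar>t\<^sup>2 / 2 * (V \<omega> - s)\<bar> + \<bar>c\<bar>"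
      by linarith
    also have "\<bar>c\<bar> \<le> a\<^sup>2 / 2"
      unfolding c_def using exp_minus_le_quadratic[OF \<open>0 \<le> a\<close>] by simp
    also have "a\<^sup>2 / 2 = t ^ 4 / 8 * s\<^sup>2"
      by (simp add: a_def power_divide power_mult_distrib flip: power_mult)
    also have "\<bar>t\<^sup>2 / 2 * (V \<omega> - s)\<bar> = t\<^sup>2 / 2 * \<bar>V \<omega> - s\<bar>"
      by (simp add: abs_mult)
    finally show "cmod (E \<omega> * R \<omega> - t\<^sup>2 / 2 * (E \<omega> * complex_of_real (V \<omega>)) + (a - c) * E \<omega>)
        \<le> \<bar>t\<bar> ^ 3 / 6 * \<bar>D \<omega>\<bar> ^ 3 + t\<^sup>2 / 2 * \<bar>V \<omega> - s\<bar> + t ^ 4 / 8 * s\<^sup>2"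
      using R_norm[of \<omega>] by linarith
  qed
  also have "\<dots> = \<bar>t\<bar> ^ 3 / 6 * expectation (\<lambda>\<omega>. \<bar>D \<omega>\<bar> ^ 3) + t\<^sup>2 / 2 * expectation (\<lambda>\<omega>. \<bar>V \<omega> - s\<bar>) + t ^ 4 / 8 * s\<^sup>2"
    by (subst Bochner_Integration.integral_add, (intro integrable)+)+ (simp add: prob_space)
  finally show ?thesis
    by (simp add: a_def E_def[abs_def])
qed

end

section \<open>Rotational symmetry\<close>

text \<open>The reflection in the hyperplane orthogonal to a unit vector \<open>w\<close>. It fixes
  \<theta> as soon as \<open>w 0 = 0\<close>, and it is symmetric, so its row and column
  orthogonality relations coincide.\<close>

definition householder :: "(nat \<Rightarrow> real) \<Rightarrow> nat \<Rightarrow> nat \<Rightarrow> real" where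
  "householder w i j = (if i = j then 1 else 0) - 2 * w i * w j"

lemma mat_vec_householder:
  "mat_vec p (householder w) x = (\<lambda>i\<in>{..<p}. x i - 2 * w i * (\<Sum>j<p. w j * x j))"
  by (auto simp: mat_vec_def householder_def fun_eq_iff algebra_simps sum_subtractf sum_distrib_left
      mult_delta_right)

lemma orthogonal_mat_householder:
  assumes "(\<Sum>k<p. (w k)\<^sup>2) = 1"
  shows "orthogonal_mat p (householder w)"
proof -
  have *: "(\<Sum>k<p. householder w i k * householder w j k) = (if i = j then 1 else 0)" if "i < p" "j < p" for i j
  proof -
    have "(\<Sum>k<p. householder w i k * householder w j k) =
      (\<Sum>k<p. (if i = k then (if i = j then 1 else 0) else 0) - (if i = k then 2 * w j * w i else 0)
         - (if j = k then 2 * w i * w j else 0) + 4 * w i * w j * (w k)\<^sup>2)"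
      by (intro sum.cong) (auto simp: householder_def algebra_simps power2_eq_square)
    also have "\<dots> = (if i = j then 1 else 0)"
      using that assms by (simp add: sum.distrib sum_subtractf flip: sum_distrib_left)
    finally show ?thesis .
  qed
  moreover have "householder w i k = householder w k i" for i k
    by (simp add: householder_def)
  ultimately show ?thesis
    by (simp add: orthogonal_mat_def)
qed

text \<open>One fixed sample size, so that every bound is non-asymptotic. The condition
  \<open>1 \<le> n\<close> makes \<open>X 1\<close> a member of the sample; its moments represent
  those of every observation.\<close>

locale rotsym_sample = prob_space M for M :: "'a measure" +
  fixes n p :: nat and F :: "real \<Rightarrow> real" and X :: "nat \<Rightarrow> 'a \<Rightarrow> nat \<Rightarrow> real"
  assumes hyp: "rotsym_hypothesis M n p F X"
    and n_pos: "1 \<le> n" and p_pos: "0 < p"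
begin

abbreviation "e1 \<equiv> e_mom M p (X 1) 1"
abbreviation "e2 \<equiv> e_cmom M p (X 1) 2"
abbreviation "e4 \<equiv> e_cmom M p (X 1) 4"
abbreviation "f2 \<equiv> f_mom M p (X 1) 2"
abbreviation "f4 \<equiv> f_mom M p (X 1) 4"

lemma indep: "indep_vars (\<lambda>_. vec_borel p) X {1..n}"
  using hyp by (simp add: rotsym_hypothesis_def)

lemma X_measurable [measurable]: "i \<in> {1..n} \<Longrightarrow> X i \<in> measurable M (vec_borel p)"
  using indep by (simp add: indep_vars_def)

lemma X_sphere:
  assumes "i \<in> {1..n}" "\<omega> \<in> space M"
  shows "(\<Sum>k<p. (X i \<omega> k)\<^sup>2) = 1"
proof -
  have "X i \<omega> \<in> unit_sphere p"
    using hyp assms by (auto simp: rotsym_hypothesis_def)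
  then show ?thesis
    by (simp add: unit_sphere_def vec_norm_def L2_set_def)
qed

lemma X_le_1:
  assumes "i \<in> {1..n}" "\<omega> \<in> space M" "k < p"
  shows "\<bar>X i \<omega> k\<bar> \<le> 1"
proof -
  have "(X i \<omega> k)\<^sup>2 \<le> (\<Sum>k<p. (X i \<omega> k)\<^sup>2)"
    using assms by (intro member_le_sum) auto
  then show ?thesis
    using X_sphere[OF assms(1,2)] by (simp add: abs_square_le_1)
qed

lemma X_orth_norm:
  assumes "i \<in> {1..n}" "\<omega> \<in> space M"
  shows "(\<Sum>k=1..<p. (X i \<omega> k)\<^sup>2) = 1 - (X i \<omega> 0)\<^sup>2"
  using X_sphere[OF assms] p_pos
  by (simp add: lessThan_atLeast0 sum.atLeast_Suc_lessThan)

lemma bounded_rv_X [bounded_rv_intros]: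
  "i \<in> {1..n} \<Longrightarrow> k < p \<Longrightarrow> bounded_rv (\<lambda>\<omega>. X i \<omega> k)"
  by (rule bounded_rvI[of _ 1]) (auto simp: X_le_1)

lemma X_distr:
  fixes f :: "(nat \<Rightarrow> real) \<Rightarrow> 'b::{banach, second_countable_topology}"
  assumes i: "i \<in> {1..n}" and [measurable]: "f \<in> borel_measurable (vec_borel p)"
  shows "expectation (\<lambda>\<omega>. f (X i \<omega>)) = expectation (\<lambda>\<omega>. f (X 1 \<omega>))"
proof -
  have one: "1 \<in> {1..n}"
    using n_pos by simp
  have "distr M (vec_borel p) (X i) = distr M (vec_borel p) (X 1)"
    using hyp i one unfolding rotsym_hypothesis_def by blast
  then have "integral\<^sup>L (distr M (vec_borel p) (X i)) f = integral\<^sup>L (distr M (vec_borel p) (X 1)) f"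
    by simp
  then show ?thesis
    using i one by (simp add: integral_distr X_measurable)
qed

lemma expectation_householder:
  fixes f :: "(nat \<Rightarrow> real) \<Rightarrow> 'b::{banach, second_countable_topology}"
  assumes i: "i \<in> {1..n}" and w: "(\<Sum>k<p. (w k)\<^sup>2) = 1" "w 0 = 0"
    and [measurable]: "f \<in> borel_measurable (vec_borel p)"
  shows "expectation (\<lambda>\<omega>. f (\<lambda>k\<in>{..<p}. X i \<omega> k - 2 * w k * (\<Sum>j<p. w j * X i \<omega> j)))
    = expectation (\<lambda>\<omega>. f (X i \<omega>))"
proof -
  let ?A = "mat_vec p (householder w)"
  have "?A (canonical_vec p 0) = canonical_vec p 0"
    using w(2) p_pos
    by (auto simp: mat_vec_householder canonical_vec_def fun_eq_iff mult_delta_right)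
  then have eq: "distr M (vec_borel p) (\<lambda>\<omega>. ?A (X i \<omega>)) = distr M (vec_borel p) (X i)"
    using hyp i orthogonal_mat_householder[OF w(1)]
    unfolding rotsym_hypothesis_def rotationally_symmetric_def by blast
  have "?A \<in> measurable (vec_borel p) (vec_borel p)"
    unfolding mat_vec_householder vec_borel_def by measurable
  then have [measurable]: "(\<lambda>\<omega>. ?A (X i \<omega>)) \<in> measurable M (vec_borel p)"
    using measurable_compose[OF X_measurable[OF i]] by blast
  have "integral\<^sup>L (distr M (vec_borel p) (\<lambda>\<omega>. ?A (X i \<omega>))) f = integral\<^sup>L (distr M (vec_borel p) (X i)) f"
    by (simp add: eq)
  then have "expectation (\<lambda>\<omega>. f (?A (X i \<omega>))) = expectation (\<lambda>\<omega>. f (X i \<omega>))"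
    using i by (simp add: integral_distr X_measurable)
  then show ?thesis
    by (simp only: mat_vec_householder)
qed

text \<open>The reflection exchanging \<open>u\<close> with the basis vector of index 1 fixes
  \<theta>, and coordinate 1 of the reflected observation is its inner product with
  \<open>u\<close>. Keeping coordinate 0 inside \<open>g\<close> preserves the joint law with the
  component along \<theta>.\<close>

lemma expectation_rotate_unit:
  assumes i: "i \<in> {1..n}" and p: "1 < p" and u: "(\<Sum>k=1..<p. (u k)\<^sup>2) = 1"
    and g [measurable]: "case_prod g \<in> borel_measurable (borel \<Otimes>\<^sub>M borel)"
  shows "expectation (\<lambda>\<omega>. g (X i \<omega> 0) (\<Sum>k=1..<p. X i \<omega> k * u k) :: real)
    = expectation (\<lambda>\<omega>. g (X i \<omega> 0) (X i \<omega> 1))"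
proof -
  \<comment> \<open>\<open>v\<close> is \<open>u\<close> minus the basis vector of index 1, hence
    normal to the reflecting hyperplane; its entry 0 is set to zero so that \<theta> stays fixed. If
    its squared length \<open>r2\<close> vanishes, \<open>u\<close> already is that basis
    vector.\<close>
  define v where "v k = (if k = 0 then 0 else u k - (if k = 1 then 1 else 0))" for k
  define r2 where "r2 = (\<Sum>k<p. (v k)\<^sup>2)"
  have split_sum: "(\<Sum>k<p. h k) = h 0 + (\<Sum>k=1..<p. h k)" for h :: "nat \<Rightarrow> real"
    using p by (simp add: lessThan_atLeast0 sum.atLeast_Suc_lessThan)
  have one: "(\<Sum>k=1..<p. h k * (if k = 1 then 1 else 0)) = h 1" for h :: "nat \<Rightarrow> real"
    using p by (simp add: mult_delta_right)
  have r2: "r2 = 2 - 2 * u 1"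
  proof -
    have "r2 = (\<Sum>k=1..<p. (u k)\<^sup>2 + (1 - 2 * u k) * (if k = 1 then 1 else 0))"
      by (auto simp: r2_def split_sum v_def power2_eq_square algebra_simps intro!: sum.cong)
    also have "\<dots> = 2 - 2 * u 1"
      using u one[of "\<lambda>k. 1 - 2 * u k"] by (simp add: sum.distrib)
    finally show ?thesis .
  qed
  show ?thesis
  proof (cases "r2 = 0")
    case True
    then have "\<forall>k\<in>{..<p}. (v k)\<^sup>2 = 0"
      unfolding r2_def by (subst (asm) sum_nonneg_eq_0_iff) auto
    then have "u k = (if k = 1 then 1 else 0)" if "k \<in> {1..<p}" for k
      using that by (auto simp: v_def split: if_splits)
    then have "(\<Sum>k=1..<p. X i \<omega> k * u k) = (\<Sum>k=1..<p. X i \<omega> k * (if k = 1 then 1 else 0))" for \<omega>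
      by (intro sum.cong) auto
    then show ?thesis
      by (simp only: one)
  next
    case False
    have "0 \<le> r2"
      by (simp add: r2_def sum_nonneg)
    with False have "0 < r2" by simp
    define w where "w k = v k / sqrt r2" for k
    have w: "(\<Sum>k<p. (w k)\<^sup>2) = 1" "w 0 = 0"
      using \<open>0 < r2\<close> by (simp_all add: w_def v_def power_divide r2_def flip: sum_divide_distrib)
    have ww: "2 * w k * (\<Sum>j<p. w j * x j) = 2 * v k * (\<Sum>j<p. v j * x j) / r2" for k x
      using \<open>0 < r2\<close> by (simp add: w_def sum_divide_distrib[symmetric] field_simps)
    have v1: "2 * v 1 = - r2"
      by (simp add: v_def r2)
    \<comment> \<open>Because \<open>2 * v 1 = - r2\<close>, the normalisation by \<open>r2\<close>
      cancels and the reflection adds exactly the inner product of \<open>v\<close> and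
      \<open>x\<close> to \<open>x 1\<close>.\<close>
    have refl1: "x 1 - 2 * w 1 * (\<Sum>j<p. w j * x j) = (\<Sum>k=1..<p. x k * u k)" for x
    proof -
      have "(\<Sum>j<p. v j * x j) = (\<Sum>k=1..<p. x k * u k - x k * (if k = 1 then 1 else 0))"
        by (simp add: split_sum v_def algebra_simps cong: sum.cong) (auto simp: v_def algebra_simps intro!: sum.cong)
      also have "\<dots> = (\<Sum>k=1..<p. x k * u k) - x 1"
        by (simp only: sum_subtractf one)
      finally show ?thesis
        unfolding ww v1 using \<open>0 < r2\<close> by simp
    qed
    have meas: "(\<lambda>x. g (x 0) (x 1)) \<in> borel_measurable (vec_borel p)"
      using p p_pos by measurable
    have "expectation (\<lambda>\<omega>. (\<lambda>x. g (x 0) (x 1)) (\<lambda>k\<in>{..<p}. X i \<omega> k - 2 * w k * (\<Sum>j<p. w j * X i \<omega> j)))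
      = expectation (\<lambda>\<omega>. (\<lambda>x. g (x 0) (x 1)) (X i \<omega>))"
      using i w by (intro expectation_householder meas) auto
    then show ?thesis
      using p p_pos w(2) by (simp add: refl1 del: One_nat_def)
  qed
qed

text \<open>Rescale \<open>u\<close> to unit length and use homogeneity of degree \<open>b\<close>.
  For \<open>u\<close> of length zero both sides carry the factor \<open>0 ^ b\<close>, and
  \<open>0 ^ 0 = 1\<close> makes this correct for \<open>b = 0\<close> as well.\<close>

lemma expectation_rotate:
  assumes i: "i \<in> {1..n}" and p: "1 < p" and [measurable]: "h \<in> borel_measurable borel"
  shows "expectation (\<lambda>\<omega>. h (X i \<omega> 0) * (\<Sum>k=1..<p. X i \<omega> k * u k) ^ b :: real)
    = sqrt (\<Sum>k=1..<p. (u k)\<^sup>2) ^ b * expectation (\<lambda>\<omega>. h (X 1 \<omega> 0) * X 1 \<omega> 1 ^ b)"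
proof -
  define c where "c = sqrt (\<Sum>k=1..<p. (u k)\<^sup>2)"
  have c2: "c\<^sup>2 = (\<Sum>k=1..<p. (u k)\<^sup>2)"
    by (simp add: c_def sum_nonneg)
  have meas: "(\<lambda>x. h (x 0) * (c * x 1) ^ b) \<in> borel_measurable (vec_borel p)"
    using p p_pos by measurable
  have "expectation (\<lambda>\<omega>. h (X i \<omega> 0) * (\<Sum>k=1..<p. X i \<omega> k * u k) ^ b)
    = expectation (\<lambda>\<omega>. h (X i \<omega> 0) * (c * X i \<omega> 1) ^ b)"
  proof (cases "c = 0")
    case True
    then have "(\<Sum>k=1..<p. (u k)\<^sup>2) = 0"
      using c2 by simp
    then have "\<forall>k\<in>{1..<p}. (u k)\<^sup>2 = 0"
      by (subst (asm) sum_nonneg_eq_0_iff) auto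
    then show ?thesis
      by (simp add: True)
  next
    case False
    have "(\<Sum>k=1..<p. (u k / c)\<^sup>2) = 1"
      using False by (simp only: power_divide sum_divide_distrib[symmetric] c2[symmetric]) simp
    moreover have "(\<lambda>(x, y). h x * (c * y) ^ b) \<in> borel_measurable (borel \<Otimes>\<^sub>M borel)"
      by measurable
    ultimately have "expectation (\<lambda>\<omega>. h (X i \<omega> 0) * (c * (\<Sum>k=1..<p. X i \<omega> k * (u k / c))) ^ b)
      = expectation (\<lambda>\<omega>. h (X i \<omega> 0) * (c * X i \<omega> 1) ^ b)"
      using expectation_rotate_unit[OF i p, of "\<lambda>k. u k / c" "\<lambda>x y. h x * (c * y) ^ b"] by blast
    then show ?thesis
      using False by (simp add: sum_divide_distrib[symmetric])
  qed
  also have "\<dots> = expectation (\<lambda>\<omega>. h (X 1 \<omega> 0) * (c * X 1 \<omega> 1) ^ b)"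
    by (rule X_distr[OF i meas])
  also have "\<dots> = expectation (\<lambda>\<omega>. c ^ b * (h (X 1 \<omega> 0) * X 1 \<omega> 1 ^ b))"
    by (simp add: power_mult_distrib mult_ac)
  finally show ?thesis
    by (simp add: c_def)
qed

lemma one_in: "1 \<in> {1..n}"
  using n_pos by simp

lemma expectation_orth_component:
  assumes i: "i \<in> {1..n}" and k: "k \<in> {1..<p}" and h: "h \<in> borel_measurable borel"
  shows "expectation (\<lambda>\<omega>. h (X i \<omega> 0) * X i \<omega> k ^ b :: real) = expectation (\<lambda>\<omega>. h (X 1 \<omega> 0) * X 1 \<omega> 1 ^ b)"
proof -
  have "1 < p" using k by simp
  have *: "(\<Sum>j=1..<p. f j * (if j = k then 1 else 0)) = f k" for f :: "nat \<Rightarrow> real"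
    using k by (simp add: mult_delta_right)
  have "(\<Sum>j=1..<p. (if j = k then 1 else 0 :: real)\<^sup>2) = 1"
    using *[of "\<lambda>j. if j = k then 1 else 0"] by (simp add: power2_eq_square)
  then show ?thesis
    using expectation_rotate[OF i \<open>1 < p\<close> h, of "\<lambda>j. if j = k then 1 else 0" b] by (simp only: *) simp
qed

text \<open>The negative of a basis vector has the same length as the basis vector itself, so the
  expectation equals its own negative.\<close>

lemma expectation_orth_odd:
  assumes p: "1 < p" and h: "h \<in> borel_measurable borel"
  shows "expectation (\<lambda>\<omega>. h (X 1 \<omega> 0) * X 1 \<omega> 1 :: real) = 0"
proof -
  have *: "(\<Sum>j=1..<p. f j * (if j = 1 then -1 else 0)) = - f 1" for f :: "nat \<Rightarrow> real"
    using p by (simp add: mult_delta_right)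
  have "(\<Sum>j=1..<p. (if j = 1 then -1 else 0 :: real)\<^sup>2) = 1"
    using *[of "\<lambda>j. if j = 1 then -1 else 0"] by (simp only: power2_eq_square) simp
  then show ?thesis
    using expectation_rotate[OF one_in p h, of "\<lambda>j. if j = 1 then -1 else 0" 1] by (simp only: *) simp
qed

lemma expectation_orth_component_0:
  assumes "i \<in> {1..n}" "k \<in> {1..<p}"
  shows "expectation (\<lambda>\<omega>. X i \<omega> k) = 0"
  using expectation_orth_component[OF assms, of "\<lambda>_. 1" 1] expectation_orth_odd[of "\<lambda>_. 1"] assms by simp

section \<open>Moments of a single observation\<close>

lemma e1_eq: "e1 = expectation (\<lambda>\<omega>. X 1 \<omega> 0)"
  by (simp add: e_mom_def vec_inner_canonical_vec p_pos)

lemma e_cmom_eq: "e_cmom M p (X 1) l = expectation (\<lambda>\<omega>. (X 1 \<omega> 0 - e1) ^ l)"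
  by (simp add: e_cmom_def vec_inner_canonical_vec p_pos)

lemma f_mom_eq: "f_mom M p (X 1) (2 * l) = expectation (\<lambda>\<omega>. (1 - (X 1 \<omega> 0)\<^sup>2) ^ l)"
proof -
  have "(X 1 \<omega> 0)\<^sup>2 \<le> 1" if "\<omega> \<in> space M" for \<omega>
    using X_le_1[OF one_in that p_pos] by (simp add: abs_square_le_1)
  then show ?thesis
    unfolding f_mom_def vec_inner_canonical_vec[OF p_pos] power_mult
    by (intro Bochner_Integration.integral_cong) auto
qed

lemma f2_eq: "f2 = expectation (\<lambda>\<omega>. 1 - (X 1 \<omega> 0)\<^sup>2)"
  using f_mom_eq[of 1] by simp

lemma f4_eq: "f4 = expectation (\<lambda>\<omega>. (1 - (X 1 \<omega> 0)\<^sup>2)\<^sup>2)"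
  using f_mom_eq[of 2] by simp

text \<open>The \<open>p - 1\<close> orthogonal coordinates have equal second moments, and their
  squares add up to \<open>1 - (X 1 \<omega> 0)\<^sup>2\<close>.\<close>

lemma expectation_orth_power2:
  assumes p: "1 < p"
  shows "expectation (\<lambda>\<omega>. (X 1 \<omega> 1)\<^sup>2) = f2 / (real p - 1)"
proof -
  have "f2 = expectation (\<lambda>\<omega>. \<Sum>k=1..<p. (X 1 \<omega> k)\<^sup>2)"
    unfolding f2_eq by (intro Bochner_Integration.integral_cong refl) (use X_orth_norm[OF one_in] in simp)
  also have "\<dots> = (\<Sum>k=1..<p. expectation (\<lambda>\<omega>. (X 1 \<omega> k)\<^sup>2))"
    using one_in by (intro Bochner_Integration.integral_sum bounded_rv_integrable bounded_rv_intros) auto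
  also have "\<dots> = (\<Sum>k=1..<p. expectation (\<lambda>\<omega>. (X 1 \<omega> 1)\<^sup>2))"
    by (intro sum.cong refl expectation_orth_component[OF one_in, of _ "\<lambda>_. 1" 2, simplified mult_1]) simp_all
  also have "\<dots> = (real p - 1) * expectation (\<lambda>\<omega>. (X 1 \<omega> 1)\<^sup>2)"
    using p by (simp add: of_nat_diff)
  finally show ?thesis
    using p by (simp add: field_simps)
qed

text \<open>
  Rotating by 45 degrees in a coordinate plane shows that the mixed fourth moments are a third of the
  pure ones, as in the Gaussian case.
\<close>

lemma expectation_orth_mixed:
  assumes k: "k \<in> {1..<p}" and l: "l \<in> {1..<p}" and kl: "k \<noteq> l"
  shows "expectation (\<lambda>\<omega>. (X 1 \<omega> k)\<^sup>2 * (X 1 \<omega> l)\<^sup>2) = expectation (\<lambda>\<omega>. X 1 \<omega> 1 ^ 4) / 3"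
proof -
  have p: "1 < p" using k by simp
  let ?m = "expectation (\<lambda>\<omega>. X 1 \<omega> 1 ^ 4)"
  have sqrt2_pow4: "sqrt 2 ^ 4 = 4"
    using power_mult[of "sqrt 2" 2 2] by simp
  have rot: "expectation (\<lambda>\<omega>. (X 1 \<omega> k + s * X 1 \<omega> l) ^ 4) = 4 * ?m" if s: "s = 1 \<or> s = -1" for s :: real
  proof -
    \<comment> \<open>The two diagonals of the coordinate plane, unnormalised: the squared length is
      2, whence the factor \<open>sqrt 2 ^ 4 = 4\<close>.\<close>
    define u where "u j = (if j = k then 1 else 0) + (if j = l then s else 0)" for j
    have *: "(\<Sum>j=1..<p. f j * u j) = f k + s * f l" for f :: "nat \<Rightarrow> real"
      using k l by (simp add: u_def mult_delta_right distrib_left sum.distrib)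
    have "(\<Sum>j=1..<p. (u j)\<^sup>2) = 2"
      using *[of u] kl s by (auto simp: power2_eq_square) (auto simp: u_def)
    then show ?thesis
      using expectation_rotate[OF one_in p, of "\<lambda>_. 1" u 4] by (simp only: *) (simp add: sqrt2_pow4)
  qed
  have pure: "expectation (\<lambda>\<omega>. X 1 \<omega> j ^ 4) = ?m" if "j \<in> {1..<p}" for j
    using expectation_orth_component[OF one_in that, of "\<lambda>_. 1" 4] by simp
  have "8 * ?m = expectation (\<lambda>\<omega>. (X 1 \<omega> k + 1 * X 1 \<omega> l) ^ 4) + expectation (\<lambda>\<omega>. (X 1 \<omega> k + (-1) * X 1 \<omega> l) ^ 4)"
    by (subst (1 2) rot) auto
  also have "\<dots> = expectation (\<lambda>\<omega>. (X 1 \<omega> k + 1 * X 1 \<omega> l) ^ 4 + (X 1 \<omega> k + (-1) * X 1 \<omega> l) ^ 4)"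
    using k l one_in by (intro Bochner_Integration.integral_add[symmetric] bounded_rv_integrable bounded_rv_intros) auto
  \<comment> \<open>Adding the two diagonals cancels the odd mixed terms. Comparing
    \<open>8 * ?m\<close> with \<open>4 * ?m\<close> plus 12 mixed moments leaves a third of
    \<open>?m\<close> for each.\<close>
  also have "\<dots> = expectation (\<lambda>\<omega>. 2 * X 1 \<omega> k ^ 4 + 2 * X 1 \<omega> l ^ 4 + 12 * ((X 1 \<omega> k)\<^sup>2 * (X 1 \<omega> l)\<^sup>2))"
    by (intro Bochner_Integration.integral_cong refl) (simp add: power4_eq_xxxx power2_eq_square algebra_simps)
  also have "\<dots> = 2 * expectation (\<lambda>\<omega>. X 1 \<omega> k ^ 4) + 2 * expectation (\<lambda>\<omega>. X 1 \<omega> l ^ 4)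
      + 12 * expectation (\<lambda>\<omega>. (X 1 \<omega> k)\<^sup>2 * (X 1 \<omega> l)\<^sup>2)"
    using k l one_in
    by (subst Bochner_Integration.integral_add, (intro bounded_rv_integrable bounded_rv_intros; simp)+)+ simp
  finally show ?thesis
    using pure[OF k] pure[OF l] by simp
qed

lemma expectation_orth_power4:
  assumes p: "1 < p"
  shows "expectation (\<lambda>\<omega>. X 1 \<omega> 1 ^ 4) = 3 * f4 / ((real p - 1) * (real p + 1))"
proof -
  let ?m = "expectation (\<lambda>\<omega>. X 1 \<omega> 1 ^ 4)"
  \<comment> \<open>Each entry is written as \<open>?m / 3\<close> plus an excess
    \<open>2 * ?m / 3\<close> on the diagonal. A row then sums to
    \<open>(p - 1) * ?m / 3 + 2 * ?m / 3 = (p + 1) * ?m / 3\<close>, which explains the factor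
    \<open>(p - 1) * (p + 1)\<close> in the result.\<close>
  have entry: "expectation (\<lambda>\<omega>. (X 1 \<omega> k)\<^sup>2 * (X 1 \<omega> l)\<^sup>2) = ?m / 3 + (if l = k then 2 * ?m / 3 else 0)"
    if "k \<in> {1..<p}" "l \<in> {1..<p}" for k l
  proof (cases "l = k")
    case True
    have "(X 1 \<omega> k)\<^sup>2 * (X 1 \<omega> k)\<^sup>2 = X 1 \<omega> k ^ 4" for \<omega>
      by (simp flip: power_add)
    then show ?thesis
      using True expectation_orth_component[OF one_in that(1), of "\<lambda>_. 1" 4] by simp
  qed (use expectation_orth_mixed[OF that] in simp)
  have "f4 = expectation (\<lambda>\<omega>. (\<Sum>k=1..<p. (X 1 \<omega> k)\<^sup>2)\<^sup>2)"
    unfolding f4_eq by (intro Bochner_Integration.integral_cong refl) (use X_orth_norm[OF one_in] in simp)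
  also have "\<dots> = expectation (\<lambda>\<omega>. \<Sum>k=1..<p. \<Sum>l=1..<p. (X 1 \<omega> k)\<^sup>2 * (X 1 \<omega> l)\<^sup>2)"
    by (simp only: power2_eq_square[of "sum _ _"] sum_product)
  also have "\<dots> = (\<Sum>k=1..<p. \<Sum>l=1..<p. expectation (\<lambda>\<omega>. (X 1 \<omega> k)\<^sup>2 * (X 1 \<omega> l)\<^sup>2))"
  proof -
    have "integrable M (\<lambda>\<omega>. (X 1 \<omega> k)\<^sup>2 * (X 1 \<omega> l)\<^sup>2)" if "k \<in> {1..<p}" "l \<in> {1..<p}" for k l
      using that one_in by (intro bounded_rv_integrable bounded_rv_intros) auto
    then show ?thesis
      by (subst Bochner_Integration.integral_sum) (auto intro!: sum.cong)
  qed
  also have "\<dots> = (\<Sum>k=1..<p. \<Sum>l=1..<p. ?m / 3 + (if l = k then 2 * ?m / 3 else 0))"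
    by (intro sum.cong refl entry)
  also have "\<dots> = (\<Sum>k=1..<p. (real p - 1) * (?m / 3) + 2 * ?m / 3)"
    using p by (intro sum.cong refl) (simp add: sum.distrib of_nat_diff)
  also have "\<dots> = (real p - 1) * (real p + 1) * ?m / 3"
    using p by (simp add: of_nat_diff field_simps)
  finally have "f4 = (real p - 1) * (real p + 1) * ?m / 3" .
  moreover have "(real p - 1) * (real p + 1) \<noteq> 0"
    using p by simp
  ultimately show ?thesis
    by (subst nonzero_eq_divide_eq) (simp_all only: mult_ac times_divide_eq_left, simp)
qed

end

section \<open>Conditioning on the past\<close>

context rotsym_sample
begin

text \<open>The sigma-algebra generated by the first \<open>j\<close> observations, kept on
  \<open>space M\<close> so that past-measurable variables remain functions of \<omega>. It matters
  only through its sets; the probability is supplied by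
  \<open>distr M (past j) (\<lambda>\<omega>. \<omega>)\<close>.\<close>

definition past :: "nat \<Rightarrow> 'a measure" where
  "past j = vimage_algebra (space M) (\<lambda>\<omega>. \<lambda>i\<in>{1..j}. X i \<omega>) (\<Pi>\<^sub>M i\<in>{1..j}. vec_borel p)"

lemma space_past [simp]: "space (past j) = space M"
  by (simp add: past_def)

lemma measurable_history:
  "j \<le> n \<Longrightarrow> (\<lambda>\<omega>. \<lambda>i\<in>{1..j}. X i \<omega>) \<in> measurable M (\<Pi>\<^sub>M i\<in>{1..j}. vec_borel p)"
  by (intro measurable_restrict X_measurable) auto

lemma X_measurable_past:
  assumes "i \<in> {1..j}" "j \<le> n"
  shows "X i \<in> measurable (past j) (vec_borel p)"
proof -
  have "(\<lambda>\<omega>. \<lambda>i\<in>{1..j}. X i \<omega>) \<in> measurable (past j) (\<Pi>\<^sub>M i\<in>{1..j}. vec_borel p)"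
    unfolding past_def using measurable_space[OF measurable_history[OF assms(2)]]
    by (intro measurable_vimage_algebra1) auto
  then have "(\<lambda>\<omega>. (\<lambda>i\<in>{1..j}. X i \<omega>) i) \<in> measurable (past j) (vec_borel p)"
    by (rule measurable_compose[OF _ measurable_component_singleton[OF assms(1)]])
  then show ?thesis
    using assms(1) by simp
qed

lemma component_measurable_past [measurable]:
  "i \<in> {1..j} \<Longrightarrow> j \<le> n \<Longrightarrow> k < p \<Longrightarrow> (\<lambda>\<omega>. X i \<omega> k) \<in> borel_measurable (past j)"
  by (rule measurable_compose[OF X_measurable_past borel_measurable_vec_component])

lemma sets_past_subset: "j \<le> n \<Longrightarrow> sets (past j) \<subseteq> sets M"
  unfolding past_def by (intro sets_image_in_sets measurable_history) simp_all

text \<open>Independence in the form that Fubini needs. It is checked on rectangles, where a set of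
  the past is the preimage of a set of histories.\<close>

lemma distr_past_pair:
  assumes j: "j < n"
  shows "distr M (past j) (\<lambda>\<omega>. \<omega>) \<Otimes>\<^sub>M distr M (vec_borel p) (X (Suc j))
    = distr M (past j \<Otimes>\<^sub>M vec_borel p) (\<lambda>\<omega>. (\<omega>, X (Suc j) \<omega>))"
    (is "?P \<Otimes>\<^sub>M ?D = ?J")
proof (rule pair_measure_eqI)
  let ?H = "\<lambda>\<omega>. \<lambda>i\<in>{1..j}. X i \<omega>" and ?N = "\<Pi>\<^sub>M i\<in>{1..j}. vec_borel p"
  let ?H' = "\<lambda>\<omega>. \<lambda>i\<in>{Suc j}. X i \<omega>" and ?N' = "\<Pi>\<^sub>M i\<in>{Suc j}. vec_borel p"
  have m1: "(\<lambda>\<omega>. \<omega>) \<in> measurable M (past j)" and m2: "X (Suc j) \<in> measurable M (vec_borel p)"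
    using sets_past_subset[of j] sets.sets_into_space[of _ "past j"] j
    by (auto intro!: measurableI simp: Int_absorb2)
  interpret P: prob_space ?P by (rule prob_space_distr[OF m1])
  interpret D: prob_space ?D by (rule prob_space_distr[OF m2])
  show "sigma_finite_measure ?P" "sigma_finite_measure ?D" ..
  show "sets (?P \<Otimes>\<^sub>M ?D) = sets ?J"
    by (simp cong: sets_pair_measure_cong)
  fix A B assume "A \<in> sets ?P" "B \<in> sets ?D"
  then have A: "A \<in> sets (past j)" and B: "B \<in> sets (vec_borel p)"
    by simp_all
  have "?H \<in> space M \<rightarrow> space ?N"
    using measurable_space[OF measurable_history[of j]] j by auto
  then obtain A' where A': "A' \<in> sets ?N" "A = ?H -` A' \<inter> space M"
    using A unfolding past_def by (auto simp: sets_vimage_algebra2)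
  define B' where "B' = (\<lambda>x. x (Suc j)) -` B \<inter> space ?N'"
  have B': "B' \<in> sets ?N'"
    unfolding B'_def by (intro measurable_sets[OF _ B] measurable_component_singleton) simp
  have "?H' \<in> measurable M ?N'"
    using j by (intro measurable_restrict X_measurable) auto
  then have XB: "X (Suc j) -` B \<inter> space M = ?H' -` B' \<inter> space M"
    unfolding B'_def by (auto dest: measurable_space)
  \<comment> \<open>Restricting an independent family to two disjoint index sets gives independent
    tuples; the next observation is therefore treated as a tuple with the single index
    \<open>Suc j\<close>.\<close>
  have "indep_var ?N ?H ?N' ?H'"
    using j by (intro indep_var_restrict[OF indep]) auto
  then have "prob ((\<lambda>\<omega>. (?H \<omega>, ?H' \<omega>)) -` (A' \<times> B') \<inter> space M) = prob (?H -` A' \<inter> space M) * prob (?H' -` B' \<inter> space M)"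
    using A'(1) B' by (rule indep_varD)
  moreover have "(\<lambda>\<omega>. (?H \<omega>, ?H' \<omega>)) -` (A' \<times> B') \<inter> space M = (?H -` A' \<inter> space M) \<inter> (?H' -` B' \<inter> space M)"
    by auto
  ultimately have prob: "prob (A \<inter> (X (Suc j) -` B \<inter> space M)) = prob A * prob (X (Suc j) -` B \<inter> space M)"
    by (simp only: A'(2) XB)
  have "A \<subseteq> space M"
    using sets.sets_into_space[OF A] by simp
  then have pre: "(\<lambda>\<omega>. \<omega>) -` A \<inter> space M = A"
      "(\<lambda>\<omega>. (\<omega>, X (Suc j) \<omega>)) -` (A \<times> B) \<inter> space M = A \<inter> (X (Suc j) -` B \<inter> space M)"
    by auto
  have "emeasure ?J (A \<times> B) = emeasure M (A \<inter> (X (Suc j) -` B \<inter> space M))"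
    using A B m1 m2 by (subst emeasure_distr) (auto simp: pre)
  moreover have "emeasure ?P A = emeasure M A"
    using A m1 by (simp add: emeasure_distr Int_absorb2[OF \<open>A \<subseteq> space M\<close>])
  moreover have "emeasure ?D B = emeasure M (X (Suc j) -` B \<inter> space M)"
    using B m2 by (simp add: emeasure_distr)
  ultimately show "emeasure ?P A * emeasure ?D B = emeasure ?J (A \<times> B)"
    by (simp add: emeasure_eq_measure prob ennreal_mult)
qed

text \<open>Substitute for conditioning on the past: \<omega> is frozen, and the next observation is
  averaged over an independent copy.\<close>

lemma expectation_independent_copy:
  fixes h :: "'a \<times> (nat \<Rightarrow> real) \<Rightarrow> 'b::{banach, second_countable_topology}"
  assumes j: "j < n" and h: "h \<in> borel_measurable (past j \<Otimes>\<^sub>M vec_borel p)"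
    and int: "integrable M (\<lambda>\<omega>. h (\<omega>, X (Suc j) \<omega>))"
  shows "expectation (\<lambda>\<omega>. h (\<omega>, X (Suc j) \<omega>)) = expectation (\<lambda>\<omega>. expectation (\<lambda>\<omega>'. h (\<omega>, X (Suc j) \<omega>')))"
proof -
  let ?P = "distr M (past j) (\<lambda>\<omega>. \<omega>)" and ?D = "distr M (vec_borel p) (X (Suc j))"
  note joint = distr_past_pair[OF j]
  have m1: "(\<lambda>\<omega>. \<omega>) \<in> measurable M (past j)" and m2: "X (Suc j) \<in> measurable M (vec_borel p)"
    using sets_past_subset[of j] sets.sets_into_space[of _ "past j"] j
    by (auto intro!: measurableI simp: Int_absorb2)
  have pair: "(\<lambda>\<omega>. (\<omega>, X (Suc j) \<omega>)) \<in> measurable M (past j \<Otimes>\<^sub>M vec_borel p)"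
    using m1 m2 by measurable
  interpret P: prob_space ?P by (rule prob_space_distr[OF m1])
  interpret D: prob_space ?D by (rule prob_space_distr[OF m2])
  interpret PD: pair_prob_space ?P ?D ..
  have int': "integrable (?P \<Otimes>\<^sub>M ?D) h"
    unfolding joint by (subst integrable_distr_eq[OF pair h]) (rule int)
  have "expectation (\<lambda>\<omega>. h (\<omega>, X (Suc j) \<omega>)) = integral\<^sup>L (?P \<Otimes>\<^sub>M ?D) h"
    unfolding joint by (rule integral_distr[OF pair h, symmetric])
  also have "\<dots> = (\<integral>\<omega>. (\<integral>x. h (\<omega>, x) \<partial>?D) \<partial>?P)"
    by (rule PD.integral_fst'[OF int', symmetric])
  also have "\<dots> = expectation (\<lambda>\<omega>. \<integral>x. h (\<omega>, x) \<partial>?D)"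
    using h by (intro integral_distr[OF m1] D.borel_measurable_lebesgue_integral) (simp add: measurable_cong_sets[OF sets_pair_measure_cong[OF refl sets_distr] refl])
  also have "\<dots> = expectation (\<lambda>\<omega>. expectation (\<lambda>\<omega>'. h (\<omega>, X (Suc j) \<omega>')))"
    by (intro Bochner_Integration.integral_cong refl integral_distr[OF m2] measurable_Pair2[OF h]) simp
  finally show ?thesis .
qed

text \<open>
  The coordinates \<open>1..<p\<close> are those orthogonal to \<open>\<theta>\<close>; \<open>Q j\<close> and \<open>R j\<close> only see this part of the partial
  sum \<open>T j\<close>, and \<open>R j\<close> pairs it with the next observation.
\<close>

definition T :: "nat \<Rightarrow> nat \<Rightarrow> 'a \<Rightarrow> real" where
  "T j k \<omega> = (\<Sum>i=1..j. X i \<omega> k)"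

definition Q :: "nat \<Rightarrow> 'a \<Rightarrow> real" where
  "Q j \<omega> = (\<Sum>k=1..<p. (T j k \<omega>)\<^sup>2)"

definition R :: "nat \<Rightarrow> 'a \<Rightarrow> real" where
  "R j \<omega> = (\<Sum>k=1..<p. X (Suc j) \<omega> k * T j k \<omega>)"

lemma T_measurable_past [measurable]:
  "i \<le> j \<Longrightarrow> j \<le> n \<Longrightarrow> k < p \<Longrightarrow> T i k \<in> borel_measurable (past j)"
  unfolding T_def[abs_def] by (intro borel_measurable_sum component_measurable_past) auto

lemma Q_measurable_past [measurable]:
  "i \<le> j \<Longrightarrow> j \<le> n \<Longrightarrow> Q i \<in> borel_measurable (past j)"
  unfolding Q_def[abs_def] by (intro borel_measurable_sum borel_measurable_power T_measurable_past) auto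

lemma R_measurable_past [measurable]:
  "i < j \<Longrightarrow> j \<le> n \<Longrightarrow> R i \<in> borel_measurable (past j)"
  unfolding R_def[abs_def]
  by (intro borel_measurable_sum borel_measurable_times T_measurable_past component_measurable_past) auto

lemma bounded_rv_T [bounded_rv_intros]: "j \<le> n \<Longrightarrow> k < p \<Longrightarrow> bounded_rv (T j k)"
  unfolding T_def[abs_def] by (intro bounded_rv_intros) auto

lemma bounded_rv_Q [bounded_rv_intros]: "j \<le> n \<Longrightarrow> bounded_rv (Q j)"
  unfolding Q_def[abs_def] by (intro bounded_rv_intros) auto

lemma bounded_rv_R [bounded_rv_intros]: "j < n \<Longrightarrow> bounded_rv (R j)"
  unfolding R_def[abs_def] by (intro bounded_rv_intros) auto

lemma Q_nonneg: "0 \<le> Q j \<omega>"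
  by (simp add: Q_def sum_nonneg)

text \<open>With the past frozen, \<open>R j\<close> is the inner product of a fresh observation
  with a fixed vector of length \<open>sqrt (Q j \<omega>)\<close>, so rotation leaves only a moment
  of one coordinate. Quantifying over all \<open>G\<close> makes this a statement about conditional
  moments.\<close>

lemma expectation_step:
  fixes G :: "'a \<Rightarrow> 'b::{banach, second_countable_topology}"
  assumes j: "j < n" and p: "1 < p"
    and G: "G \<in> borel_measurable (past j)" "bounded_rv G"
    and \<phi>: "\<phi> \<in> borel_measurable borel" "bounded_rv (\<lambda>\<omega>. \<phi> (X (Suc j) \<omega> 0))"
  shows "expectation (\<lambda>\<omega>. (\<phi> (X (Suc j) \<omega> 0) * R j \<omega> ^ b) *\<^sub>R G \<omega>)
    = expectation (\<lambda>\<omega>. \<phi> (X 1 \<omega> 0) * X 1 \<omega> 1 ^ b) *\<^sub>R expectation (\<lambda>\<omega>. sqrt (Q j \<omega>) ^ b *\<^sub>R G \<omega>)"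
proof -
  have Suc: "Suc j \<in> {1..n}"
    using j by simp
  define h where "h = (\<lambda>(\<omega>, x). (\<phi> (x 0) * (\<Sum>k=1..<p. x k * T j k \<omega>) ^ b) *\<^sub>R G \<omega>)"
  have h: "h \<in> borel_measurable (past j \<Otimes>\<^sub>M vec_borel p)"
  proof -
    note [measurable] = G(1) \<phi>(1)
    have [measurable]: "(\<lambda>z. T j k (fst z)) \<in> borel_measurable (past j \<Otimes>\<^sub>M vec_borel p)" if "k < p" for k
      using that j by (intro measurable_compose[OF measurable_fst T_measurable_past]) auto
    have [measurable]: "(\<lambda>z. snd z k) \<in> borel_measurable (past j \<Otimes>\<^sub>M vec_borel p)" if "k < p" for k
      using that by (intro measurable_compose[OF measurable_snd borel_measurable_vec_component]) auto
    have "(\<lambda>z. \<Sum>k=1..<p. snd z k * T j k (fst z)) \<in> borel_measurable (past j \<Otimes>\<^sub>M vec_borel p)"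
      by (intro borel_measurable_sum borel_measurable_times) auto
    then show ?thesis
      using p_pos unfolding h_def case_prod_beta by measurable
  qed
  have "expectation (\<lambda>\<omega>. (\<phi> (X (Suc j) \<omega> 0) * R j \<omega> ^ b) *\<^sub>R G \<omega>) = expectation (\<lambda>\<omega>. h (\<omega>, X (Suc j) \<omega>))"
    by (simp add: h_def R_def)
  also have "\<dots> = expectation (\<lambda>\<omega>. expectation (\<lambda>\<omega>'. h (\<omega>, X (Suc j) \<omega>')))"
    using j G(2) \<phi>(2)
    by (intro expectation_independent_copy h) (auto simp: h_def R_def[symmetric] intro!: bounded_rv_integrable bounded_rv_intros)
  also have "\<dots> = expectation (\<lambda>\<omega>. expectation (\<lambda>\<omega>. \<phi> (X 1 \<omega> 0) * X 1 \<omega> 1 ^ b) *\<^sub>R (sqrt (Q j \<omega>) ^ b *\<^sub>R G \<omega>))"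
  proof (intro Bochner_Integration.integral_cong refl)
    fix \<omega>
    have "integrable M (\<lambda>\<omega>'. \<phi> (X (Suc j) \<omega>' 0) * (\<Sum>k=1..<p. X (Suc j) \<omega>' k * T j k \<omega>) ^ b)"
      using \<phi>(2) Suc by (intro bounded_rv_integrable bounded_rv_intros) auto
    then have "expectation (\<lambda>\<omega>'. h (\<omega>, X (Suc j) \<omega>'))
      = expectation (\<lambda>\<omega>'. \<phi> (X (Suc j) \<omega>' 0) * (\<Sum>k=1..<p. X (Suc j) \<omega>' k * T j k \<omega>) ^ b) *\<^sub>R G \<omega>"
      by (simp add: h_def)
    \<comment> \<open>In the inner integral only the copy \<omega>' varies; the numbers
      \<open>T j k \<omega>\<close> are constants and play the part of the vector
      \<open>u\<close>.\<close>
    also have "\<dots> = (sqrt (Q j \<omega>) ^ b * expectation (\<lambda>\<omega>. \<phi> (X 1 \<omega> 0) * X 1 \<omega> 1 ^ b)) *\<^sub>R G \<omega>"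
      unfolding Q_def by (subst expectation_rotate[OF Suc p \<phi>(1)]) (rule refl)
    finally show "expectation (\<lambda>\<omega>'. h (\<omega>, X (Suc j) \<omega>'))
      = expectation (\<lambda>\<omega>. \<phi> (X 1 \<omega> 0) * X 1 \<omega> 1 ^ b) *\<^sub>R (sqrt (Q j \<omega>) ^ b *\<^sub>R G \<omega>)"
      by (simp add: mult.commute)
  qed
  also have "\<dots> = expectation (\<lambda>\<omega>. \<phi> (X 1 \<omega> 0) * X 1 \<omega> 1 ^ b) *\<^sub>R expectation (\<lambda>\<omega>. sqrt (Q j \<omega>) ^ b *\<^sub>R G \<omega>)"
    by (rule integral_scaleR_right)
  finally show ?thesis .
qed

context
  fixes j :: nat and G :: "'a \<Rightarrow> 'b::{banach, second_countable_topology}"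
  assumes j: "j < n" and p_gt_1: "1 < p" and G: "G \<in> borel_measurable (past j)" "bounded_rv G"
begin

lemma expectation_step_0:
  assumes "\<phi> \<in> borel_measurable borel" "bounded_rv (\<lambda>\<omega>. \<phi> (X (Suc j) \<omega> 0))"
  shows "expectation (\<lambda>\<omega>. \<phi> (X (Suc j) \<omega> 0) *\<^sub>R G \<omega>) = expectation (\<lambda>\<omega>. \<phi> (X 1 \<omega> 0)) *\<^sub>R expectation G"
  using expectation_step[OF j p_gt_1 G assms, of 0] by simp

lemma expectation_step_1:
  assumes "\<phi> \<in> borel_measurable borel" "bounded_rv (\<lambda>\<omega>. \<phi> (X (Suc j) \<omega> 0))"
  shows "expectation (\<lambda>\<omega>. (\<phi> (X (Suc j) \<omega> 0) * R j \<omega>) *\<^sub>R G \<omega>) = 0"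
  using expectation_step[OF j p_gt_1 G assms, of 1] expectation_orth_odd[OF p_gt_1 assms(1)] by simp

lemma expectation_step_2:
  "expectation (\<lambda>\<omega>. (R j \<omega>)\<^sup>2 *\<^sub>R G \<omega>) = (f2 / (real p - 1)) *\<^sub>R expectation (\<lambda>\<omega>. Q j \<omega> *\<^sub>R G \<omega>)"
  using expectation_step[OF j p_gt_1 G, of "\<lambda>_. 1" 2] expectation_orth_power2[OF p_gt_1]
  by (simp add: Q_nonneg bounded_rv_const)

lemma expectation_step_4:
  "expectation (\<lambda>\<omega>. R j \<omega> ^ 4 *\<^sub>R G \<omega>)
    = (3 * f4 / ((real p - 1) * (real p + 1))) *\<^sub>R expectation (\<lambda>\<omega>. (Q j \<omega>)\<^sup>2 *\<^sub>R G \<omega>)"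
proof -
  have "sqrt (Q j \<omega>) ^ 4 = (Q j \<omega>)\<^sup>2" for \<omega>
    using power_mult[of "sqrt (Q j \<omega>)" 2 2] by (simp add: Q_nonneg)
  then show ?thesis
    using expectation_step[OF j p_gt_1 G, of "\<lambda>_. 1" 4] expectation_orth_power4[OF p_gt_1]
    by (simp add: bounded_rv_const)
qed

end

section \<open>Mean and variance of the squared length of the orthogonal partial sum\<close>

lemma Q_Suc:
  assumes "j < n" "\<omega> \<in> space M"
  shows "Q (Suc j) \<omega> = Q j \<omega> + 2 * R j \<omega> + (1 - (X (Suc j) \<omega> 0)\<^sup>2)"
proof -
  have "Suc j \<in> {1..n}"
    using assms(1) by simp
  then show ?thesis
    using X_orth_norm[OF _ assms(2), of "Suc j", symmetric]
    by (simp add: Q_def R_def T_def power2_sum sum.distrib sum_distrib_left mult_ac)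
qed

lemma expectation_R:
  assumes "j < n" "1 < p"
  shows "expectation (R j) = 0"
proof -
  have "expectation (\<lambda>\<omega>. (1 * R j \<omega>) *\<^sub>R (1 :: real)) = 0"
    by (intro expectation_step_1[OF assms, where \<phi> = "\<lambda>_. 1"] borel_measurable_const bounded_rv_const)
  then show ?thesis by simp
qed

lemma expectation_Q:
  assumes p: "1 < p"
  shows "j \<le> n \<Longrightarrow> expectation (Q j) = j * f2"
proof (induction j)
  case 0
  then show ?case by (simp add: Q_def T_def)
next
  case (Suc j)
  have j: "j < n" and in_n: "Suc j \<in> {1..n}"
    using Suc.prems by auto
  have "expectation (\<lambda>\<omega>. 1 - (X (Suc j) \<omega> 0)\<^sup>2) = f2"
    unfolding f2_eq using X_distr[OF in_n, of "\<lambda>x. 1 - (x 0)\<^sup>2"] p_pos by simp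
  moreover have "expectation (Q (Suc j)) = expectation (\<lambda>\<omega>. Q j \<omega> + 2 * R j \<omega> + (1 - (X (Suc j) \<omega> 0)\<^sup>2))"
    by (intro Bochner_Integration.integral_cong refl) (simp add: Q_Suc j)
  moreover have "\<dots> = expectation (Q j) + 2 * expectation (R j) + expectation (\<lambda>\<omega>. 1 - (X (Suc j) \<omega> 0)\<^sup>2)"
    using j p_pos in_n
    by (subst Bochner_Integration.integral_add, (intro bounded_rv_integrable bounded_rv_intros; simp)+)+ simp
  moreover have "expectation (Q j) = j * f2"
    using Suc.IH j by simp
  ultimately show ?case
    by (simp only: expectation_R[OF j p]) (simp add: algebra_simps)
qed

lemma f2_nonneg: "0 \<le> f2"
  by (simp add: f_mom_def)

lemma f4_nonneg: "0 \<le> f4"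
  by (simp add: f_mom_def)

text \<open>In the recursion for \<open>Q\<close> the centred old value, the cross term
  \<open>R j\<close> and the centred new squared length are pairwise uncorrelated, so their
  variances add. The first contribution to the bound collects the \<open>f4\<close>, the second the
  cross terms, each small because one coordinate of \<open>W\<close> carries only the share
  \<open>1 / (p - 1)\<close>.\<close>

lemma variance_Q_le:
  assumes p: "1 < p"
  shows "j \<le> n \<Longrightarrow> expectation (\<lambda>\<omega>. (Q j \<omega> - j * f2)\<^sup>2) \<le> j * f4 + 2 * (real j)\<^sup>2 * f2\<^sup>2 / (real p - 1)"
proof (induction j)
  case 0
  have "Q 0 \<omega> = 0" for \<omega>
    by (simp add: Q_def T_def)
  then show ?case by simp
next
  case (Suc j)
  have j: "j < n" and in_n: "Suc j \<in> {1..n}"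
    using Suc.prems by auto
  define A where "A \<omega> = Q j \<omega> - j * f2" for \<omega>
  define C where "C x = 1 - x\<^sup>2 - f2" for x :: real
  let ?C = "\<lambda>\<omega>. C (X (Suc j) \<omega> 0)"
  have A: "A \<in> borel_measurable (past j)" "bounded_rv A"
    using j unfolding A_def[abs_def]
    by (intro borel_measurable_diff Q_measurable_past borel_measurable_const bounded_rv_intros; simp)+
  have C: "C \<in> borel_measurable borel" "bounded_rv ?C"
    unfolding C_def[abs_def] using in_n p_pos by (measurable, intro bounded_rv_intros)
  have one: "(\<lambda>_. 1 :: real) \<in> borel_measurable (past j)" "bounded_rv (\<lambda>_. 1 :: real)"
    by (auto intro: bounded_rv_const)
  have EA: "expectation A = 0"
    using expectation_Q[OF p, of j] j bounded_rv_Q[of j] unfolding A_def[abs_def]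
    by (subst Bochner_Integration.integral_diff) (auto simp: prob_space intro: bounded_rv_integrable)
  have AR: "expectation (\<lambda>\<omega>. A \<omega> * R j \<omega>) = 0"
    using expectation_step_1[OF j p A, of "\<lambda>_. 1"] by (simp add: bounded_rv_const mult.commute)
  have AC: "expectation (\<lambda>\<omega>. A \<omega> * ?C \<omega>) = 0"
    using expectation_step_0[OF j p A C] EA by (simp add: mult.commute)
  have RC: "expectation (\<lambda>\<omega>. R j \<omega> * ?C \<omega>) = 0"
    using expectation_step_1[OF j p one C] by (simp add: mult.commute)
  have RR: "expectation (\<lambda>\<omega>. (R j \<omega>)\<^sup>2) = f2 / (real p - 1) * (j * f2)"
    using expectation_step_2[OF j p one] expectation_Q[OF p, of j] j by simp
  have CC: "expectation (\<lambda>\<omega>. (?C \<omega>)\<^sup>2) = f4 - f2\<^sup>2"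
  proof -
    have "expectation (\<lambda>\<omega>. (?C \<omega>)\<^sup>2) = expectation (\<lambda>\<omega>. (C (X 1 \<omega> 0))\<^sup>2)"
      by (intro X_distr[OF in_n, of "\<lambda>x. (C (x 0))\<^sup>2"] borel_measurable_power
          measurable_compose[OF borel_measurable_vec_component[OF p_pos] C(1)])
    also have "\<dots> = expectation (\<lambda>\<omega>. (1 - (X 1 \<omega> 0)\<^sup>2)\<^sup>2) - (expectation (\<lambda>\<omega>. 1 - (X 1 \<omega> 0)\<^sup>2))\<^sup>2"
      unfolding C_def f2_eq using p_pos one_in
      by (intro variance_eq bounded_rv_integrable bounded_rv_intros) auto
    finally show ?thesis
      by (simp only: f2_eq f4_eq)
  qed
  have "expectation (\<lambda>\<omega>. (Q (Suc j) \<omega> - Suc j * f2)\<^sup>2)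
    = expectation (\<lambda>\<omega>. (A \<omega>)\<^sup>2 + 4 * (R j \<omega>)\<^sup>2 + (?C \<omega>)\<^sup>2 + 4 * (A \<omega> * R j \<omega>) + 2 * (A \<omega> * ?C \<omega>) + 4 * (R j \<omega> * ?C \<omega>))"
    by (intro Bochner_Integration.integral_cong refl)
      (simp add: Q_Suc j A_def C_def power2_eq_square algebra_simps)
  also have "\<dots> = expectation (\<lambda>\<omega>. (A \<omega>)\<^sup>2) + 4 * expectation (\<lambda>\<omega>. (R j \<omega>)\<^sup>2) + expectation (\<lambda>\<omega>. (?C \<omega>)\<^sup>2)
      + 4 * expectation (\<lambda>\<omega>. A \<omega> * R j \<omega>) + 2 * expectation (\<lambda>\<omega>. A \<omega> * ?C \<omega>) + 4 * expectation (\<lambda>\<omega>. R j \<omega> * ?C \<omega>)"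
    by (simp add: bounded_rv_integrable bounded_rv_intros j A(2) C(2))
  also have "\<dots> = expectation (\<lambda>\<omega>. (A \<omega>)\<^sup>2) + 4 * real j * (f2\<^sup>2 / (real p - 1)) + f4 - f2\<^sup>2"
    by (simp only: AR AC RC RR CC) (simp add: power2_eq_square)
  \<comment> \<open>The negative term is dropped, and \<open>4 * j\<close> is enlarged to
    \<open>4 * j + 2 = 2 * ((j + 1)\<^sup>2 - j\<^sup>2)\<close>, precisely the growth that the
    claimed bound allows.\<close>
  also have "\<dots> \<le> (j * f4 + 2 * (real j)\<^sup>2 * f2\<^sup>2 / (real p - 1)) + (4 * real j + 2) * (f2\<^sup>2 / (real p - 1)) + f4"
  proof -
    have "expectation (\<lambda>\<omega>. (A \<omega>)\<^sup>2) \<le> j * f4 + 2 * (real j)\<^sup>2 * f2\<^sup>2 / (real p - 1)"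
      unfolding A_def using Suc by simp
    moreover have "4 * real j * (f2\<^sup>2 / (real p - 1)) \<le> (4 * real j + 2) * (f2\<^sup>2 / (real p - 1))"
      using p by (intro mult_right_mono) auto
    ultimately show ?thesis
      using zero_le_power2[of f2] by linarith
  qed
  also have "\<dots> = Suc j * f4 + 2 * (real (Suc j))\<^sup>2 * f2\<^sup>2 / (real p - 1)"
    by (simp add: power2_eq_square add_divide_distrib algebra_simps)
  finally show ?case .
qed

end

section \<open>The martingale part\<close>

declare One_nat_def [simp del]

context rotsym_sample
begin

lemma expectation_centered: "i \<in> {1..n} \<Longrightarrow> expectation (\<lambda>\<omega>. X i \<omega> 0 - e1) = 0"
  using X_distr[of i "\<lambda>x. x 0 - e1"] p_pos one_in bounded_rv_X[OF one_in p_pos]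
  by (simp add: e1_eq prob_space bounded_rv_integrable del: One_nat_def)

text \<open>The difference with index \<open>j\<close> belongs to observation \<open>Suc j\<close>,
  so it is centred given \<open>past j\<close>. Scale \<open>s\<close> and weight \<open>c\<close>
  of the linear part stay free; they are specialised to \<open>scale\<close> and
  \<open>center\<close> at the end.\<close>

definition incr :: "real \<Rightarrow> real \<Rightarrow> nat \<Rightarrow> 'a \<Rightarrow> real" where
  "incr s c j \<omega> = s * (c * (X (Suc j) \<omega> 0 - e1) + R j \<omega>)"

text \<open>The conditional variance of \<open>incr s c j\<close> given the past, affine in
  \<open>Q j\<close>; \<open>mean_var\<close> is its expectation and serves as the deterministic
  variance of the step.\<close>

definition cond_var :: "real \<Rightarrow> real \<Rightarrow> nat \<Rightarrow> 'a \<Rightarrow> real" where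
  "cond_var s c j \<omega> = s\<^sup>2 * (c\<^sup>2 * e2 + f2 / (real p - 1) * Q j \<omega>)"

definition mean_var :: "real \<Rightarrow> real \<Rightarrow> nat \<Rightarrow> real" where
  "mean_var s c j = s\<^sup>2 * (c\<^sup>2 * e2 + f2 / (real p - 1) * (j * f2))"

definition mart :: "real \<Rightarrow> real \<Rightarrow> nat \<Rightarrow> 'a \<Rightarrow> real" where
  "mart s c j \<omega> = (\<Sum>i<j. incr s c i \<omega>)"

lemma bounded_rv_incr [bounded_rv_intros]: "j < n \<Longrightarrow> bounded_rv (incr s c j)"
  unfolding incr_def[abs_def] using p_pos by (intro bounded_rv_intros) auto

lemma bounded_rv_cond_var [bounded_rv_intros]: "j \<le> n \<Longrightarrow> bounded_rv (cond_var s c j)"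
  unfolding cond_var_def[abs_def] by (intro bounded_rv_intros)

lemma bounded_rv_mart [bounded_rv_intros]: "j \<le> n \<Longrightarrow> bounded_rv (mart s c j)"
  unfolding mart_def[abs_def] by (intro bounded_rv_intros) auto

lemma incr_measurable_past: "i < j \<Longrightarrow> j \<le> n \<Longrightarrow> incr s c i \<in> borel_measurable (past j)"
  unfolding incr_def[abs_def] using p_pos
  by (intro borel_measurable_times borel_measurable_add borel_measurable_diff borel_measurable_const
      component_measurable_past R_measurable_past) auto

lemma mart_measurable_past: "j \<le> n \<Longrightarrow> mart s c j \<in> borel_measurable (past j)"
  unfolding mart_def[abs_def] by (intro borel_measurable_sum incr_measurable_past) auto

lemma e2_nonneg: "0 \<le> e2"
  unfolding e_cmom_eq by simp

lemma mean_var_nonneg: "1 < p \<Longrightarrow> 0 \<le> mean_var s c j"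
  by (auto simp: mean_var_def e2_nonneg f2_nonneg intro!: mult_nonneg_nonneg add_nonneg_nonneg divide_nonneg_nonneg)

lemma bounded_rv_centered: "j < n \<Longrightarrow> bounded_rv (\<lambda>\<omega>. X (Suc j) \<omega> 0 - e1)"
  using p_pos by (intro bounded_rv_intros) auto

context
  fixes j :: nat and G :: "'a \<Rightarrow> 'b::{banach, second_countable_topology}"
  assumes j: "j < n" and p: "1 < p" and G: "G \<in> borel_measurable (past j)" "bounded_rv G"
begin

lemma expectation_incr: "expectation (\<lambda>\<omega>. incr s c j \<omega> *\<^sub>R G \<omega>) = 0"
proof -
  have Z: "expectation (\<lambda>\<omega>. (X (Suc j) \<omega> 0 - e1) *\<^sub>R G \<omega>) = 0"
  proof -
    have "expectation (\<lambda>\<omega>. (X (Suc j) \<omega> 0 - e1) *\<^sub>R G \<omega>) = expectation (\<lambda>\<omega>. X 1 \<omega> 0 - e1) *\<^sub>R expectation G"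
      by (rule expectation_step_0[OF j p G, where \<phi> = "\<lambda>x. x - e1"]) (auto intro: bounded_rv_centered j)
    then show ?thesis
      by (simp only: expectation_centered[OF one_in]) simp
  qed
  have R: "expectation (\<lambda>\<omega>. R j \<omega> *\<^sub>R G \<omega>) = 0"
    using expectation_step_1[OF j p G, where \<phi> = "\<lambda>_. 1"] by (simp only: mult_1) (simp add: bounded_rv_const)
  have "expectation (\<lambda>\<omega>. incr s c j \<omega> *\<^sub>R G \<omega>)
    = expectation (\<lambda>\<omega>. (s * c) *\<^sub>R ((X (Suc j) \<omega> 0 - e1) *\<^sub>R G \<omega>) + s *\<^sub>R (R j \<omega> *\<^sub>R G \<omega>))"
    by (simp add: incr_def algebra_simps)
  also have "\<dots> = (s * c) *\<^sub>R expectation (\<lambda>\<omega>. (X (Suc j) \<omega> 0 - e1) *\<^sub>R G \<omega>) + s *\<^sub>R expectation (\<lambda>\<omega>. R j \<omega> *\<^sub>R G \<omega>)"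
  proof -
    have "integrable M (\<lambda>\<omega>. (X (Suc j) \<omega> 0 - e1) *\<^sub>R G \<omega>)" "integrable M (\<lambda>\<omega>. R j \<omega> *\<^sub>R G \<omega>)"
      by (intro bounded_rv_integrable bounded_rv_scaleR bounded_rv_centered G bounded_rv_R j)+
    then show ?thesis
      by (subst Bochner_Integration.integral_add) (auto simp del: scaleR_scaleR)
  qed
  finally show ?thesis
    by (simp only: Z R) simp
qed

text \<open>The cross term between the linear part and \<open>R j\<close> vanishes, since given the
  past and the component along \<theta> the sign of \<open>R j\<close> is symmetric. The variances
  of the two parts thus add with no interaction.\<close>

lemma expectation_incr_power2:
  "expectation (\<lambda>\<omega>. (incr s c j \<omega>)\<^sup>2 *\<^sub>R G \<omega>) = expectation (\<lambda>\<omega>. cond_var s c j \<omega> *\<^sub>R G \<omega>)"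
proof -
  let ?Z = "\<lambda>\<omega>. X (Suc j) \<omega> 0 - e1"
  have ZZ: "expectation (\<lambda>\<omega>. (?Z \<omega>)\<^sup>2 *\<^sub>R G \<omega>) = e2 *\<^sub>R expectation G"
    unfolding e_cmom_eq
    by (rule expectation_step_0[OF j p G, where \<phi> = "\<lambda>x. (x - e1)\<^sup>2"]) (auto intro!: bounded_rv_power bounded_rv_centered j)
  have ZR: "expectation (\<lambda>\<omega>. (?Z \<omega> * R j \<omega>) *\<^sub>R G \<omega>) = 0"
    by (rule expectation_step_1[OF j p G, where \<phi> = "\<lambda>x. x - e1"]) (auto intro: bounded_rv_centered j)
  note RR = expectation_step_2[OF j p G]
  have int: "integrable M (\<lambda>\<omega>. (?Z \<omega>)\<^sup>2 *\<^sub>R G \<omega>)" "integrable M (\<lambda>\<omega>. (?Z \<omega> * R j \<omega>) *\<^sub>R G \<omega>)"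
      "integrable M (\<lambda>\<omega>. (R j \<omega>)\<^sup>2 *\<^sub>R G \<omega>)" "integrable M (\<lambda>\<omega>. Q j \<omega> *\<^sub>R G \<omega>)" "integrable M G"
    using j by (intro bounded_rv_integrable bounded_rv_scaleR bounded_rv_mult bounded_rv_power bounded_rv_centered
        G bounded_rv_R bounded_rv_Q; simp)+
  have "expectation (\<lambda>\<omega>. (incr s c j \<omega>)\<^sup>2 *\<^sub>R G \<omega>)
    = expectation (\<lambda>\<omega>. (s\<^sup>2 * c\<^sup>2) *\<^sub>R ((?Z \<omega>)\<^sup>2 *\<^sub>R G \<omega>) + (2 * s\<^sup>2 * c) *\<^sub>R ((?Z \<omega> * R j \<omega>) *\<^sub>R G \<omega>) + s\<^sup>2 *\<^sub>R ((R j \<omega>)\<^sup>2 *\<^sub>R G \<omega>))"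
    by (intro Bochner_Integration.integral_cong refl)
      (simp add: incr_def power2_eq_square algebra_simps flip: scaleR_add_left)
  also have "\<dots> = (s\<^sup>2 * c\<^sup>2) *\<^sub>R expectation (\<lambda>\<omega>. (?Z \<omega>)\<^sup>2 *\<^sub>R G \<omega>)
      + (2 * s\<^sup>2 * c) *\<^sub>R expectation (\<lambda>\<omega>. (?Z \<omega> * R j \<omega>) *\<^sub>R G \<omega>)
      + s\<^sup>2 *\<^sub>R expectation (\<lambda>\<omega>. (R j \<omega>)\<^sup>2 *\<^sub>R G \<omega>)"
    by (simp only: Bochner_Integration.integral_add int integrable_scaleR_right Bochner_Integration.integrable_add integral_scaleR_right)
  also have "\<dots> = (s\<^sup>2 * c\<^sup>2 * e2) *\<^sub>R expectation G + (s\<^sup>2 * (f2 / (real p - 1))) *\<^sub>R expectation (\<lambda>\<omega>. Q j \<omega> *\<^sub>R G \<omega>)"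
    by (simp only: ZZ ZR RR) simp
  also have "\<dots> = expectation (\<lambda>\<omega>. (s\<^sup>2 * c\<^sup>2 * e2) *\<^sub>R G \<omega> + (s\<^sup>2 * (f2 / (real p - 1))) *\<^sub>R (Q j \<omega> *\<^sub>R G \<omega>))"
    by (simp only: Bochner_Integration.integral_add int integrable_scaleR_right integral_scaleR_right)
  also have "\<dots> = expectation (\<lambda>\<omega>. cond_var s c j \<omega> *\<^sub>R G \<omega>)"
    by (simp add: cond_var_def algebra_simps)
  finally show ?thesis .
qed

end

context
  fixes j :: nat
  assumes j: "j < n" and p: "1 < p"
begin

lemma one_past: "(\<lambda>_. 1 :: real) \<in> borel_measurable (past j)" "bounded_rv (\<lambda>_. 1 :: real)"
  by (auto intro: bounded_rv_const)

lemma expectation_incr_squared: "expectation (\<lambda>\<omega>. (incr s c j \<omega>)\<^sup>2) = mean_var s c j"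
proof -
  have "expectation (\<lambda>\<omega>. (incr s c j \<omega>)\<^sup>2) = expectation (cond_var s c j)"
    using expectation_incr_power2[OF j p one_past] by simp
  also have "\<dots> = mean_var s c j"
    using j by (simp add: cond_var_def[abs_def] mean_var_def bounded_rv_integrable bounded_rv_Q prob_space expectation_Q[OF p])
  finally show ?thesis .
qed

lemma expectation_Q_squared_le: "expectation (\<lambda>\<omega>. (Q j \<omega>)\<^sup>2) \<le> j * f4 + 3 * (real j)\<^sup>2 * f2\<^sup>2"
proof -
  have "expectation (\<lambda>\<omega>. (Q j \<omega> - expectation (Q j))\<^sup>2) = expectation (\<lambda>\<omega>. (Q j \<omega>)\<^sup>2) - (expectation (Q j))\<^sup>2"
    using j by (intro variance_eq bounded_rv_integrable bounded_rv_intros) auto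
  then have "expectation (\<lambda>\<omega>. (Q j \<omega>)\<^sup>2) = expectation (\<lambda>\<omega>. (Q j \<omega> - j * f2)\<^sup>2) + (j * f2)\<^sup>2"
    using expectation_Q[OF p, of j] j by simp
  also have "\<dots> \<le> (j * f4 + 2 * (real j)\<^sup>2 * f2\<^sup>2 / (real p - 1)) + (j * f2)\<^sup>2"
    using variance_Q_le[OF p, of j] j by simp
  \<comment> \<open>Here \<open>p - 1 \<ge> 1\<close>; together with the squared mean this gives the
    constant 3 = 2 + 1.\<close>
  also have "2 * (real j)\<^sup>2 * f2\<^sup>2 / (real p - 1) \<le> 2 * (real j)\<^sup>2 * f2\<^sup>2 / 1"
    using p by (intro divide_left_mono) auto
  finally show ?thesis
    by (simp add: power_mult_distrib)
qed

text \<open>The bound is made independent of \<open>j\<close>, so that summation over the steps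
  costs just a factor n.\<close>

lemma expectation_incr_power4_le:
  "expectation (\<lambda>\<omega>. incr s c j \<omega> ^ 4)
    \<le> 8 * s ^ 4 * (c ^ 4 * e4 + 3 * f4 / ((real p - 1) * (real p + 1)) * (n * f4 + 3 * (real n)\<^sup>2 * f2\<^sup>2))"
proof -
  let ?Z = "\<lambda>\<omega>. X (Suc j) \<omega> 0 - e1"
  have Z: "expectation (\<lambda>\<omega>. ?Z \<omega> ^ 4) = e4"
    unfolding e_cmom_eq using X_distr[of "Suc j" "\<lambda>x. (x 0 - e1) ^ 4"] j p_pos by simp
  have "expectation (\<lambda>\<omega>. R j \<omega> ^ 4) = 3 * f4 / ((real p - 1) * (real p + 1)) * expectation (\<lambda>\<omega>. (Q j \<omega>)\<^sup>2)"
    using expectation_step_4[OF j p one_past] by simp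
  also have "\<dots> \<le> 3 * f4 / ((real p - 1) * (real p + 1)) * (n * f4 + 3 * (real n)\<^sup>2 * f2\<^sup>2)"
  proof (rule mult_left_mono)
    have "expectation (\<lambda>\<omega>. (Q j \<omega>)\<^sup>2) \<le> j * f4 + 3 * (real j)\<^sup>2 * f2\<^sup>2"
      by (rule expectation_Q_squared_le)
    also have "\<dots> \<le> n * f4 + 3 * (real n)\<^sup>2 * f2\<^sup>2"
      using j f4_nonneg f2_nonneg by (intro add_mono mult_mono power_mono) auto
    finally show "expectation (\<lambda>\<omega>. (Q j \<omega>)\<^sup>2) \<le> n * f4 + 3 * (real n)\<^sup>2 * f2\<^sup>2" .
    show "0 \<le> 3 * f4 / ((real p - 1) * (real p + 1))"
      using p f4_nonneg by simp
  qed
  finally have R: "expectation (\<lambda>\<omega>. R j \<omega> ^ 4) \<le> 3 * f4 / ((real p - 1) * (real p + 1)) * (n * f4 + 3 * (real n)\<^sup>2 * f2\<^sup>2)" .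
  have int: "integrable M (\<lambda>\<omega>. incr s c j \<omega> ^ 4)" "integrable M (\<lambda>\<omega>. ?Z \<omega> ^ 4)" "integrable M (\<lambda>\<omega>. R j \<omega> ^ 4)"
    using j by (intro bounded_rv_integrable bounded_rv_power bounded_rv_incr bounded_rv_R bounded_rv_centered; simp)+
  have "expectation (\<lambda>\<omega>. incr s c j \<omega> ^ 4) \<le> expectation (\<lambda>\<omega>. 8 * s ^ 4 * (c ^ 4 * ?Z \<omega> ^ 4 + R j \<omega> ^ 4))"
  proof (rule integral_mono[OF int(1)])
    show "integrable M (\<lambda>\<omega>. 8 * s ^ 4 * (c ^ 4 * ?Z \<omega> ^ 4 + R j \<omega> ^ 4))"
      using int by simp
    fix \<omega>
    have "incr s c j \<omega> ^ 4 = s ^ 4 * (c * ?Z \<omega> + R j \<omega>) ^ 4"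
      by (simp add: incr_def power_mult_distrib)
    also have "\<dots> \<le> s ^ 4 * (8 * ((c * ?Z \<omega>) ^ 4 + R j \<omega> ^ 4))"
      by (intro mult_left_mono power4_sum_le) simp
    finally show "incr s c j \<omega> ^ 4 \<le> 8 * s ^ 4 * (c ^ 4 * ?Z \<omega> ^ 4 + R j \<omega> ^ 4)"
      by (simp only: power_mult_distrib mult_ac)
  qed
  also have "\<dots> = 8 * s ^ 4 * (c ^ 4 * e4 + expectation (\<lambda>\<omega>. R j \<omega> ^ 4))"
    using int by (simp add: Z)
  also have "\<dots> \<le> 8 * s ^ 4 * (c ^ 4 * e4 + 3 * f4 / ((real p - 1) * (real p + 1)) * (n * f4 + 3 * (real n)\<^sup>2 * f2\<^sup>2))"
    using R by (intro mult_left_mono add_left_mono) auto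
  finally show ?thesis .
qed

lemma mean_var_squared_le: "(mean_var s c j)\<^sup>2 \<le> expectation (\<lambda>\<omega>. incr s c j \<omega> ^ 4)"
proof -
  have "(expectation (\<lambda>\<omega>. (incr s c j \<omega>)\<^sup>2))\<^sup>2 \<le> expectation (\<lambda>\<omega>. ((incr s c j \<omega>)\<^sup>2)\<^sup>2)"
    using j by (intro expectation_power2_le bounded_rv_intros)
  then show ?thesis
    by (simp add: expectation_incr_squared flip: power_mult)
qed

lemma expectation_abs_incr_cube_le:
  assumes "0 < r"
  shows "expectation (\<lambda>\<omega>. \<bar>incr s c j \<omega>\<bar> ^ 3) \<le> (r * mean_var s c j + expectation (\<lambda>\<omega>. incr s c j \<omega> ^ 4) / r) / 2"
proof -
  have int: "integrable M (\<lambda>\<omega>. \<bar>incr s c j \<omega>\<bar> ^ 3)" "integrable M (\<lambda>\<omega>. (incr s c j \<omega>)\<^sup>2)" "integrable M (\<lambda>\<omega>. incr s c j \<omega> ^ 4)"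
    using j by (intro bounded_rv_integrable bounded_rv_intros; simp)+
  have "expectation (\<lambda>\<omega>. \<bar>incr s c j \<omega>\<bar> ^ 3) \<le> expectation (\<lambda>\<omega>. (r * (incr s c j \<omega>)\<^sup>2 + incr s c j \<omega> ^ 4 / r) / 2)"
    using int by (intro integral_mono abs_cube_le_weighted assms) auto
  also have "\<dots> = (r * mean_var s c j + expectation (\<lambda>\<omega>. incr s c j \<omega> ^ 4) / r) / 2"
    using int by (simp add: expectation_incr_squared)
  finally show ?thesis .
qed

text \<open>The difference is a multiple of \<open>Q j\<close> minus its mean; the variance bound
  for \<open>Q j\<close> controls its first absolute moment, which is all that the one-step
  comparison requires.\<close>

lemma expectation_abs_cond_var_le:
  "expectation (\<lambda>\<omega>. \<bar>cond_var s c j \<omega> - mean_var s c j\<bar>)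
    \<le> s\<^sup>2 * (f2 / (real p - 1)) * sqrt (n * f4 + 2 * (real n)\<^sup>2 * f2\<^sup>2 / (real p - 1))"
proof -
  have nonneg: "0 \<le> s\<^sup>2 * (f2 / (real p - 1))"
    using p f2_nonneg by simp
  have "\<bar>cond_var s c j \<omega> - mean_var s c j\<bar> = s\<^sup>2 * (f2 / (real p - 1)) * \<bar>Q j \<omega> - j * f2\<bar>" for \<omega>
  proof -
    have "cond_var s c j \<omega> - mean_var s c j = s\<^sup>2 * (f2 / (real p - 1)) * (Q j \<omega> - j * f2)"
      by (simp add: cond_var_def mean_var_def right_diff_distrib distrib_left mult.assoc)
    then show ?thesis
      by (simp only: abs_mult[of "s\<^sup>2 * (f2 / (real p - 1))"] abs_of_nonneg[OF nonneg])
  qed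
  then have "expectation (\<lambda>\<omega>. \<bar>cond_var s c j \<omega> - mean_var s c j\<bar>) = s\<^sup>2 * (f2 / (real p - 1)) * expectation (\<lambda>\<omega>. \<bar>Q j \<omega> - j * f2\<bar>)"
    by (simp only: integral_mult_right_zero)
  also have "\<dots> \<le> s\<^sup>2 * (f2 / (real p - 1)) * sqrt (n * f4 + 2 * (real n)\<^sup>2 * f2\<^sup>2 / (real p - 1))"
  proof (intro mult_left_mono nonneg)
    have "expectation (\<lambda>\<omega>. \<bar>Q j \<omega> - j * f2\<bar>) \<le> sqrt (expectation (\<lambda>\<omega>. (Q j \<omega> - j * f2)\<^sup>2))"
      using j by (intro expectation_abs_le bounded_rv_intros) auto
    also have "\<dots> \<le> sqrt (j * f4 + 2 * (real j)\<^sup>2 * f2\<^sup>2 / (real p - 1))"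
      using j by (intro real_sqrt_le_mono variance_Q_le p) auto
    also have "\<dots> \<le> sqrt (n * f4 + 2 * (real n)\<^sup>2 * f2\<^sup>2 / (real p - 1))"
      using j p f4_nonneg f2_nonneg by (intro real_sqrt_le_mono add_mono mult_mono divide_right_mono power_mono) auto
    finally show "expectation (\<lambda>\<omega>. \<bar>Q j \<omega> - j * f2\<bar>) \<le> sqrt (n * f4 + 2 * (real n)\<^sup>2 * f2\<^sup>2 / (real p - 1))" .
  qed
  finally show ?thesis .
qed

lemma char_mart_step:
  "cmod ((CLINT \<omega>|M. iexp (t * mart s c (Suc j) \<omega>)) - complex_of_real (exp (- (t\<^sup>2 * mean_var s c j / 2))) * (CLINT \<omega>|M. iexp (t * mart s c j \<omega>)))
    \<le> \<bar>t\<bar> ^ 3 / 6 * expectation (\<lambda>\<omega>. \<bar>incr s c j \<omega>\<bar> ^ 3)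
      + t\<^sup>2 / 2 * expectation (\<lambda>\<omega>. \<bar>cond_var s c j \<omega> - mean_var s c j\<bar>) + t ^ 4 / 8 * (mean_var s c j)\<^sup>2"
proof -
  have b: "bounded_rv (mart s c j)" "bounded_rv (incr s c j)" "bounded_rv (cond_var s c j)"
    using j by (intro bounded_rv_intros; simp)+
  have G: "(\<lambda>\<omega>. iexp (t * mart s c j \<omega>)) \<in> borel_measurable (past j)" "bounded_rv (\<lambda>\<omega>. iexp (t * mart s c j \<omega>))"
  proof -
    have [measurable]: "mart s c j \<in> borel_measurable (past j)"
      using j by (intro mart_measurable_past) simp
    show "(\<lambda>\<omega>. iexp (t * mart s c j \<omega>)) \<in> borel_measurable (past j)"
      by measurable
    show "bounded_rv (\<lambda>\<omega>. iexp (t * mart s c j \<omega>))"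
      using j by (intro bounded_rv_intros) simp
  qed
  have "cmod ((CLINT \<omega>|M. iexp (t * (mart s c j \<omega> + incr s c j \<omega>))) - complex_of_real (exp (- (t\<^sup>2 * mean_var s c j / 2))) * (CLINT \<omega>|M. iexp (t * mart s c j \<omega>)))
    \<le> \<bar>t\<bar> ^ 3 / 6 * expectation (\<lambda>\<omega>. \<bar>incr s c j \<omega>\<bar> ^ 3)
      + t\<^sup>2 / 2 * expectation (\<lambda>\<omega>. \<bar>cond_var s c j \<omega> - mean_var s c j\<bar>) + t ^ 4 / 8 * (mean_var s c j)\<^sup>2"
    by (rule char_martingale_step[OF b _ _ mean_var_nonneg[OF p]])
      (use expectation_incr[OF j p G, of s c] expectation_incr_power2[OF j p G, of s c] in
        \<open>simp_all only: scaleR_conv_of_real mult.commute of_real_power\<close>)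
  then show ?thesis
    by (simp add: mart_def)
qed

end

text \<open>Each step multiplies the previous error by a factor
  \<open>exp (- (t\<^sup>2 * mean_var s c m / 2)) \<le> 1\<close>, so the one-step errors simply
  accumulate.\<close>

lemma char_mart:
  assumes p: "1 < p"
  shows "m \<le> n \<Longrightarrow> cmod ((CLINT \<omega>|M. iexp (t * mart s c m \<omega>)) - complex_of_real (exp (- (t\<^sup>2 / 2 * (\<Sum>j<m. mean_var s c j)))))
    \<le> (\<Sum>j<m. \<bar>t\<bar> ^ 3 / 6 * expectation (\<lambda>\<omega>. \<bar>incr s c j \<omega>\<bar> ^ 3)
      + t\<^sup>2 / 2 * expectation (\<lambda>\<omega>. \<bar>cond_var s c j \<omega> - mean_var s c j\<bar>) + t ^ 4 / 8 * (mean_var s c j)\<^sup>2)"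
proof (induction m)
  case 0
  then show ?case by (simp add: mart_def prob_space)
next
  case (Suc m)
  define a where "a = exp (- (t\<^sup>2 * mean_var s c m / 2))"
  define b where "b = exp (- (t\<^sup>2 / 2 * (\<Sum>j<m. mean_var s c j)))"
  have a: "0 \<le> a" "a \<le> 1"
    using mean_var_nonneg[OF p, of s c m] by (auto simp: a_def)
  have ab: "exp (- (t\<^sup>2 / 2 * (\<Sum>j<Suc m. mean_var s c j))) = a * b"
    unfolding a_def b_def by (simp add: distrib_left exp_add[symmetric] flip: exp_add)
  let ?E = "\<lambda>m. CLINT \<omega>|M. iexp (t * mart s c m \<omega>)"
  have "cmod (?E (Suc m) - complex_of_real (a * b)) = cmod ((?E (Suc m) - of_real a * ?E m) + of_real a * (?E m - of_real b))"
    by (simp add: algebra_simps)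
  also have "\<dots> \<le> cmod (?E (Suc m) - of_real a * ?E m) + cmod (of_real a * (?E m - of_real b))"
    by (rule norm_triangle_ineq)
  also have "cmod (of_real a * (?E m - of_real b)) \<le> cmod (?E m - of_real b)"
    using a by (simp add: norm_mult mult_left_le_one_le del: of_real_mult)
  finally show ?case
    using Suc.IH Suc.prems char_mart_step[of m t s c] p
    unfolding ab unfolding a_def[symmetric] b_def[symmetric] by simp
qed

end

section \<open>Decomposition of the statistic\<close>

text \<open>Every index belongs to \<open>m - 1\<close> pairs. This is the origin of the factor
  \<open>n - 1\<close> in the linear part of the martingale.\<close>

lemma sum_pairs_add:
  fixes z :: "nat \<Rightarrow> real"
  shows "(\<Sum>j=1..m. \<Sum>i=1..<j. z i + z j) = (real m - 1) * (\<Sum>i=1..m. z i)"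
proof (induction m)
  case (Suc m)
  have "{1..<Suc m} = {1..m}"
    by auto
  then show ?case
    using Suc by (simp add: sum.distrib algebra_simps)
qed simp

context rotsym_sample
begin

lemma expectation_component_prod:
  assumes i: "i \<in> {1..j}" and j: "j < n" and k: "k < p"
  shows "expectation (\<lambda>\<omega>. X i \<omega> k * X (Suc j) \<omega> k) = expectation (\<lambda>\<omega>. X i \<omega> k) * expectation (\<lambda>\<omega>. X (Suc j) \<omega> k)"
proof -
  define h where "h = (\<lambda>(\<omega>, x). X i \<omega> k * x k)"
  have "(\<lambda>z. X i (fst z) k * snd z k) \<in> borel_measurable (past j \<Otimes>\<^sub>M vec_borel p)"
    using i j k
    by (intro borel_measurable_times measurable_compose[OF measurable_fst component_measurable_past]
        measurable_compose[OF measurable_snd borel_measurable_vec_component]) auto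
  then have h: "h \<in> borel_measurable (past j \<Otimes>\<^sub>M vec_borel p)"
    by (simp add: h_def case_prod_beta)
  have "integrable M (\<lambda>\<omega>. h (\<omega>, X (Suc j) \<omega>))"
    using i j k unfolding h_def prod.case by (intro bounded_rv_integrable bounded_rv_intros) auto
  then show ?thesis
    using expectation_independent_copy[OF j h] by (simp add: h_def)
qed

text \<open>Coordinates of distinct observations are uncorrelated, and by symmetry only the
  coordinate along \<theta> has a nonzero mean.\<close>

lemma expectation_inner:
  assumes i: "i \<in> {1..<j}" and j: "j \<in> {1..n}"
  shows "expectation (\<lambda>\<omega>. vec_inner p (X i \<omega>) (X j \<omega>)) = e1\<^sup>2"
proof -
  obtain l where l: "j = Suc l" "i \<in> {1..l}" "l < n"
    using i j by (cases j) auto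
  have in_n: "i \<in> {1..n}" "j \<in> {1..n}"
    using l by auto
  have "expectation (\<lambda>\<omega>. vec_inner p (X i \<omega>) (X j \<omega>)) = (\<Sum>k<p. expectation (\<lambda>\<omega>. X i \<omega> k * X j \<omega> k))"
    unfolding vec_inner_def using in_n
    by (intro Bochner_Integration.integral_sum bounded_rv_integrable bounded_rv_intros) auto
  also have "\<dots> = (\<Sum>k<p. expectation (\<lambda>\<omega>. X i \<omega> k) * expectation (\<lambda>\<omega>. X j \<omega> k))"
    unfolding l(1) using l by (intro sum.cong refl expectation_component_prod) auto
  also have "\<dots> = (\<Sum>k<p. if k = 0 then e1\<^sup>2 else 0)"
  proof (intro sum.cong refl)
    fix k assume "k \<in> {..<p}"
    have "expectation (\<lambda>\<omega>. X m \<omega> k) = (if k = 0 then e1 else 0)" if m: "m \<in> {1..n}" for m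
    proof (cases "k = 0")
      case True
      then show ?thesis
        unfolding e1_eq using X_distr[OF m, of "\<lambda>x. x 0"] p_pos by simp
    next
      case False
      then show ?thesis
        using expectation_orth_component_0[OF m, of k] \<open>k \<in> {..<p}\<close> by simp
    qed
    then show "expectation (\<lambda>\<omega>. X i \<omega> k) * expectation (\<lambda>\<omega>. X j \<omega> k) = (if k = 0 then e1\<^sup>2 else 0)"
      using in_n by (simp add: power2_eq_square)
  qed
  also have "\<dots> = e1\<^sup>2"
    using p_pos by simp
  finally show ?thesis .
qed

definition pair_sum :: "'a \<Rightarrow> real" where
  "pair_sum \<omega> = (\<Sum>j=1..n. \<Sum>i=1..<j. vec_inner p (X i \<omega>) (X j \<omega>) - e1\<^sup>2)"

lemma bounded_rv_inner:
  "i \<in> {1..n} \<Longrightarrow> j \<in> {1..n} \<Longrightarrow> bounded_rv (\<lambda>\<omega>. vec_inner p (X i \<omega>) (X j \<omega>))"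
  unfolding vec_inner_def by (intro bounded_rv_intros) auto

lemma bounded_rv_pair_sum: "bounded_rv pair_sum"
  unfolding pair_sum_def[abs_def] by (intro bounded_rv_intros bounded_rv_inner) auto

lemma expectation_pair_sum: "expectation pair_sum = 0"
proof -
  have int: "integrable M (\<lambda>\<omega>. vec_inner p (X i \<omega>) (X j \<omega>) - e1\<^sup>2)" if "j \<in> {1..n}" "i \<in> {1..<j}" for i j
    using that by (intro bounded_rv_integrable bounded_rv_intros bounded_rv_inner) auto
  have "expectation pair_sum = (\<Sum>j=1..n. expectation (\<lambda>\<omega>. \<Sum>i=1..<j. vec_inner p (X i \<omega>) (X j \<omega>) - e1\<^sup>2))"
    unfolding pair_sum_def[abs_def] using int
    by (intro Bochner_Integration.integral_sum Bochner_Integration.integrable_sum) auto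
  also have "\<dots> = (\<Sum>j=1..n. \<Sum>i=1..<j. expectation (\<lambda>\<omega>. vec_inner p (X i \<omega>) (X j \<omega>) - e1\<^sup>2))"
    using int by (intro sum.cong refl Bochner_Integration.integral_sum) auto
  also have "\<dots> = (\<Sum>j=1..n. \<Sum>i=1..<j. 0)"
  proof (intro sum.cong refl)
    fix i j assume *: "j \<in> {1..n}" "i \<in> {1..<j}"
    then have "i \<in> {1..n}"
      by auto
    then show "expectation (\<lambda>\<omega>. vec_inner p (X i \<omega>) (X j \<omega>) - e1\<^sup>2) = 0"
      using * expectation_inner[of i j] by (subst Bochner_Integration.integral_diff)
        (auto simp: prob_space intro!: bounded_rv_integrable bounded_rv_inner)
  qed
  finally show ?thesis by simp
qed

text \<open>The diagonal inner products are all 1 on the sphere, so the squared length of the sum is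
  affine in the sum over pairs. This converts the definition through the sample mean into the
  double-sum form.\<close>

lemma norm_sum_eq:
  assumes \<omega>: "\<omega> \<in> space M"
  shows "m \<le> n \<Longrightarrow> (\<Sum>k<p. (\<Sum>i=1..m. X i \<omega> k)\<^sup>2) = m + 2 * (\<Sum>j=1..m. \<Sum>i=1..<j. vec_inner p (X i \<omega>) (X j \<omega>))"
proof (induction m)
  case (Suc m)
  have *: "{1..<Suc m} = {1..m}"
    by auto
  have "(\<Sum>k<p. (\<Sum>i=1..Suc m. X i \<omega> k)\<^sup>2)
    = (\<Sum>k<p. (\<Sum>i=1..m. X i \<omega> k)\<^sup>2 + 2 * (\<Sum>i=1..m. X i \<omega> k * X (Suc m) \<omega> k) + (X (Suc m) \<omega> k)\<^sup>2)"
    by (intro sum.cong refl) (simp add: power2_sum sum_distrib_left sum_distrib_right mult_ac)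
  also have "\<dots> = (\<Sum>k<p. (\<Sum>i=1..m. X i \<omega> k)\<^sup>2) + 2 * (\<Sum>k<p. \<Sum>i=1..m. X i \<omega> k * X (Suc m) \<omega> k) + 1"
    using X_sphere[OF _ \<omega>, of "Suc m"] Suc.prems by (simp add: sum.distrib sum_distrib_left)
  also have "(\<Sum>k<p. \<Sum>i=1..m. X i \<omega> k * X (Suc m) \<omega> k) = (\<Sum>i=1..m. vec_inner p (X i \<omega>) (X (Suc m) \<omega>))"
    unfolding vec_inner_def by (rule sum.swap)
  finally show ?case
    using Suc by (simp add: *)
qed simp

lemma rayleigh_st_eq:
  assumes \<omega>: "\<omega> \<in> space M"
  shows "rayleigh_st n p X \<omega> = sqrt (2 * real p) / n * (pair_sum \<omega> + (\<Sum>j=1..n. \<Sum>i=1..<j. e1\<^sup>2))"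
proof -
  let ?S = "\<Sum>j=1..n. \<Sum>i=1..<j. vec_inner p (X i \<omega>) (X j \<omega>)"
  have n: "real n > 0" and p: "real p > 0"
    using n_pos p_pos by auto
  have "(vec_norm p (sample_mean n p (\<lambda>i. X i \<omega>)))\<^sup>2 = (\<Sum>k<p. ((\<Sum>i=1..n. X i \<omega> k) / n)\<^sup>2)"
    unfolding vec_norm_def L2_set_def sample_mean_def by (simp add: sum_nonneg)
  also have "\<dots> = (n + 2 * ?S) / (real n)\<^sup>2"
    using norm_sum_eq[OF \<omega>, of n] by (simp add: power_divide flip: sum_divide_distrib)
  finally have norm: "(vec_norm p (sample_mean n p (\<lambda>i. X i \<omega>)))\<^sup>2 = (n + 2 * ?S) / (real n)\<^sup>2" .
  have "real n * real p * (vec_norm p (sample_mean n p (\<lambda>i. X i \<omega>)))\<^sup>2 - real p = (2 * real p) * ?S / n"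
    unfolding norm using n by (simp add: field_simps power2_eq_square)
  then have "rayleigh_st n p X \<omega> = (sqrt (2 * real p) * sqrt (2 * real p)) * ?S / n / sqrt (2 * real p)"
    unfolding rayleigh_st_def by simp
  also have "\<dots> = sqrt (2 * real p) / n * ?S"
  proof -
    have "(a * a) * b / c / a = a / c * b" if "a \<noteq> 0" for a b c :: real
      using that by (simp add: field_simps)
    moreover have "sqrt (2 * real p) \<noteq> 0"
      using p by simp
    ultimately show ?thesis by blast
  qed
  also have "?S = pair_sum \<omega> + (\<Sum>j=1..n. \<Sum>i=1..<j. e1\<^sup>2)"
    unfolding pair_sum_def by (simp only: sum.distrib[symmetric] diff_add_cancel)
  finally show ?thesis .
qed

lemma rayleigh_st_centered:
  assumes \<omega>: "\<omega> \<in> space M"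
  shows "rayleigh_st n p X \<omega> - expectation (rayleigh_st n p X) = sqrt (2 * real p) / n * pair_sum \<omega>"
proof -
  let ?c = "\<Sum>j=1..n. \<Sum>i=1..<j. e1\<^sup>2"
  have "expectation (rayleigh_st n p X) = expectation (\<lambda>\<omega>. sqrt (2 * real p) / n * (pair_sum \<omega> + ?c))"
    by (intro Bochner_Integration.integral_cong refl rayleigh_st_eq)
  also have "\<dots> = sqrt (2 * real p) / n * ?c"
    using bounded_rv_integrable[OF bounded_rv_pair_sum] by (simp add: expectation_pair_sum prob_space del: sum_constant)
  finally show ?thesis
    using rayleigh_st_eq[OF \<omega>] by (simp add: distrib_left del: sum_constant)
qed

text \<open>
  The part of the statistic that is quadratic in the first components is negligible under the
  assumption on the minimum; it is kept apart from the martingale.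
\<close>

definition quad :: "nat \<Rightarrow> 'a \<Rightarrow> real" where
  "quad m \<omega> = (\<Sum>j=1..m. \<Sum>i=1..<j. (X i \<omega> 0 - e1) * (X j \<omega> 0 - e1))"

lemma bounded_rv_quad: "m \<le> n \<Longrightarrow> bounded_rv (quad m)"
  unfolding quad_def[abs_def] using p_pos by (intro bounded_rv_intros) auto

lemma pair_sum_decomp:
  "s * pair_sum \<omega> = s * quad n \<omega> + mart s ((real n - 1) * e1) n \<omega>"
proof -
  let ?Z = "\<lambda>i. X i \<omega> 0 - e1"
  have split_sum: "(\<Sum>k<p. h k) = h 0 + (\<Sum>k=1..<p. h k)" for h :: "nat \<Rightarrow> real"
    using p_pos by (simp add: lessThan_atLeast0 sum.atLeast_Suc_lessThan One_nat_def)
  have "vec_inner p (X i \<omega>) (X j \<omega>) - e1\<^sup>2 = ?Z i * ?Z j + e1 * (?Z i + ?Z j) + (\<Sum>k=1..<p. X i \<omega> k * X j \<omega> k)" for i j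
    by (simp add: vec_inner_def split_sum algebra_simps power2_eq_square)
  then have "pair_sum \<omega> = quad n \<omega> + e1 * (\<Sum>j=1..n. \<Sum>i=1..<j. ?Z i + ?Z j) + (\<Sum>j=1..n. \<Sum>i=1..<j. \<Sum>k=1..<p. X i \<omega> k * X j \<omega> k)"
    unfolding pair_sum_def quad_def sum_distrib_left sum.distrib[symmetric] by simp
  also have "(\<Sum>j=1..n. \<Sum>i=1..<j. \<Sum>k=1..<p. X i \<omega> k * X j \<omega> k) = (\<Sum>j<n. R j \<omega>)"
  proof -
    have "(\<Sum>j=1..n. \<Sum>i=1..<j. \<Sum>k=1..<p. X i \<omega> k * X j \<omega> k) = (\<Sum>j<n. \<Sum>i=1..<Suc j. \<Sum>k=1..<p. X i \<omega> k * X (Suc j) \<omega> k)"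
      by (simp add: lessThan_atLeast0 One_nat_def sum.atLeast_Suc_atMost_Suc_shift atLeastLessThanSuc_atLeastAtMost[symmetric] sum.shift_bounds_Suc_ivl del: sum.op_ivl_Suc)
    also have "\<dots> = (\<Sum>j<n. R j \<omega>)"
    proof (intro sum.cong refl)
      fix j
      have "(\<Sum>i=1..<Suc j. \<Sum>k=1..<p. X i \<omega> k * X (Suc j) \<omega> k) = (\<Sum>k=1..<p. \<Sum>i=1..j. X i \<omega> k * X (Suc j) \<omega> k)"
        unfolding atLeastLessThanSuc_atLeastAtMost by (rule sum.swap)
      then show "(\<Sum>i=1..<Suc j. \<Sum>k=1..<p. X i \<omega> k * X (Suc j) \<omega> k) = R j \<omega>"
        by (simp only: R_def T_def sum_distrib_left mult.commute)
    qed
    finally show ?thesis .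
  qed
  also have "e1 * (\<Sum>j=1..n. \<Sum>i=1..<j. ?Z i + ?Z j) = (\<Sum>j<n. (real n - 1) * e1 * ?Z (Suc j))"
  proof -
    have "(\<Sum>i=1..n. ?Z i) = (\<Sum>j<n. ?Z (Suc j))"
      by (simp add: lessThan_atLeast0 One_nat_def atLeastLessThanSuc_atLeastAtMost[symmetric] sum.shift_bounds_Suc_ivl del: sum.op_ivl_Suc)
    then show ?thesis
      unfolding sum_pairs_add by (simp only: sum_distrib_left mult_ac)
  qed
  finally have "pair_sum \<omega> = quad n \<omega> + (\<Sum>j<n. (real n - 1) * e1 * ?Z (Suc j) + R j \<omega>)"
    by (simp only: sum.distrib add.assoc)
  then show ?thesis
    by (simp only: mart_def incr_def distrib_left sum_distrib_left)
qed

text \<open>Adding an observation changes \<open>quad m\<close> by a centred variable times the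
  partial sum \<open>U\<close> of its predecessors. The second moment of \<open>U\<close> is thus
  needed for the recursion, which is why both claims share one induction.\<close>

lemma expectation_quad_squared:
  assumes p: "1 < p"
  shows "m \<le> n \<Longrightarrow> expectation (\<lambda>\<omega>. (quad m \<omega>)\<^sup>2) = real m * (real m - 1) / 2 * e2\<^sup>2
     \<and> expectation (\<lambda>\<omega>. (\<Sum>i=1..m. X i \<omega> 0 - e1)\<^sup>2) = m * e2"
proof (induction m)
  case 0
  then show ?case by (simp add: quad_def)
next
  case (Suc m)
  then have m: "m < n" by simp
  define U where "U \<omega> = (\<Sum>i=1..m. X i \<omega> 0 - e1)" for \<omega>
  let ?Z = "\<lambda>\<omega>. X (Suc m) \<omega> 0 - e1"
  have U: "U \<in> borel_measurable (past m)" "bounded_rv U"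
    unfolding U_def[abs_def] using m p_pos
    by (auto intro!: borel_measurable_sum borel_measurable_diff component_measurable_past bounded_rv_intros)
  have A: "quad m \<in> borel_measurable (past m)" "bounded_rv (quad m)"
    unfolding quad_def[abs_def] using m p_pos
    by (auto intro!: borel_measurable_sum borel_measurable_times borel_measurable_diff component_measurable_past bounded_rv_intros)
  have Z: "(\<lambda>x. x - e1) \<in> borel_measurable borel" "bounded_rv ?Z"
    using bounded_rv_centered[OF m] by auto
  have Z2: "(\<lambda>x. (x - e1)\<^sup>2) \<in> borel_measurable borel" "bounded_rv (\<lambda>\<omega>. (?Z \<omega>)\<^sup>2)"
    using bounded_rv_power[OF Z(2)] by auto
  have one_Z: "expectation (\<lambda>\<omega>. ?Z \<omega> *\<^sub>R G \<omega>) = 0" if "G \<in> borel_measurable (past m)" "bounded_rv G" for G :: "'a \<Rightarrow> real"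
    using expectation_step_0[OF m p that Z] expectation_centered[OF one_in] by simp
  have one_Z2: "expectation (\<lambda>\<omega>. (?Z \<omega>)\<^sup>2 *\<^sub>R G \<omega>) = e2 * expectation G" if "G \<in> borel_measurable (past m)" "bounded_rv G" for G :: "'a \<Rightarrow> real"
    using expectation_step_0[OF m p that Z2] by (simp add: e_cmom_eq)
  have U2: "(\<lambda>\<omega>. (U \<omega>)\<^sup>2) \<in> borel_measurable (past m)" "bounded_rv (\<lambda>\<omega>. (U \<omega>)\<^sup>2)"
    using U by (auto intro!: bounded_rv_intros)
  have AU: "(\<lambda>\<omega>. quad m \<omega> * U \<omega>) \<in> borel_measurable (past m)" "bounded_rv (\<lambda>\<omega>. quad m \<omega> * U \<omega>)"
    using U A by (auto intro!: bounded_rv_intros)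
  have IH: "expectation (\<lambda>\<omega>. (quad m \<omega>)\<^sup>2) = real m * (real m - 1) / 2 * e2\<^sup>2" "expectation (\<lambda>\<omega>. (U \<omega>)\<^sup>2) = m * e2"
    using Suc unfolding U_def by simp_all
  have int: "integrable M (\<lambda>\<omega>. (U \<omega>)\<^sup>2)" "integrable M (\<lambda>\<omega>. ?Z \<omega> *\<^sub>R U \<omega>)" "integrable M (\<lambda>\<omega>. (?Z \<omega>)\<^sup>2 *\<^sub>R (1 :: real))"
      "integrable M (\<lambda>\<omega>. (quad m \<omega>)\<^sup>2)" "integrable M (\<lambda>\<omega>. ?Z \<omega> *\<^sub>R (quad m \<omega> * U \<omega>))" "integrable M (\<lambda>\<omega>. (?Z \<omega>)\<^sup>2 *\<^sub>R (U \<omega>)\<^sup>2)"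
    by (intro bounded_rv_integrable bounded_rv_scaleR bounded_rv_power A(2) U(2) Z(2) AU(2) bounded_rv_const)+
  have quad_Suc: "quad (Suc m) \<omega> = quad m \<omega> + ?Z \<omega> * U \<omega>" for \<omega>
  proof -
    have "{1..<Suc m} = {1..m}" by auto
    then show ?thesis
      by (simp add: quad_def U_def sum_distrib_left mult.commute)
  qed
  have "expectation (\<lambda>\<omega>. (U \<omega> + ?Z \<omega>)\<^sup>2) = expectation (\<lambda>\<omega>. (U \<omega>)\<^sup>2 + 2 * (?Z \<omega> *\<^sub>R U \<omega>) + (?Z \<omega>)\<^sup>2 *\<^sub>R 1)"
    by (intro Bochner_Integration.integral_cong refl) (simp add: power2_sum)
  also have "\<dots> = expectation (\<lambda>\<omega>. (U \<omega>)\<^sup>2) + 2 * expectation (\<lambda>\<omega>. ?Z \<omega> *\<^sub>R U \<omega>) + expectation (\<lambda>\<omega>. (?Z \<omega>)\<^sup>2 *\<^sub>R 1)"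
    by (simp only: Bochner_Integration.integral_add int integrable_mult_right Bochner_Integration.integrable_add integral_mult_right_zero)
  also have "\<dots> = Suc m * e2"
    by (simp only: one_Z[OF U] one_Z2[OF borel_measurable_const bounded_rv_const] IH) (simp add: prob_space algebra_simps)
  finally have 1: "expectation (\<lambda>\<omega>. (\<Sum>i=1..Suc m. X i \<omega> 0 - e1)\<^sup>2) = Suc m * e2"
    by (simp add: U_def)
  have "expectation (\<lambda>\<omega>. (quad (Suc m) \<omega>)\<^sup>2) = expectation (\<lambda>\<omega>. (quad m \<omega>)\<^sup>2 + 2 * (?Z \<omega> *\<^sub>R (quad m \<omega> * U \<omega>)) + (?Z \<omega>)\<^sup>2 *\<^sub>R (U \<omega>)\<^sup>2)"
    by (intro Bochner_Integration.integral_cong refl) (simp add: quad_Suc power2_sum power_mult_distrib)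
  also have "\<dots> = expectation (\<lambda>\<omega>. (quad m \<omega>)\<^sup>2) + 2 * expectation (\<lambda>\<omega>. ?Z \<omega> *\<^sub>R (quad m \<omega> * U \<omega>)) + expectation (\<lambda>\<omega>. (?Z \<omega>)\<^sup>2 *\<^sub>R (U \<omega>)\<^sup>2)"
    by (simp only: Bochner_Integration.integral_add int integrable_mult_right Bochner_Integration.integrable_add integral_mult_right_zero)
  also have "\<dots> = real (Suc m) * (real (Suc m) - 1) / 2 * e2\<^sup>2"
    by (simp only: one_Z[OF AU] one_Z2[OF U2] IH) (simp add: field_simps power2_eq_square)
  finally show ?case
    using 1 by simp
qed

end

section \<open>The limit\<close>

text \<open>A positive number over zero is infinite in \<open>ereal\<close> and cannot lie below
  \<epsilon>; for a zero denominator the hypothesis therefore forces \<open>a = 0\<close>. The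
  product form is safe in all cases.\<close>

lemma ereal_divide_less_imp_le:
  assumes "ereal a / ereal b < ereal \<epsilon>" "0 \<le> a" "0 \<le> b"
  shows "a \<le> \<epsilon> * b"
proof (cases "b = 0")
  case True
  then show ?thesis
    using assms by (cases "a = 0") (auto simp: zero_ereal_def[symmetric] divide_ereal_def)
next
  case False
  then show ?thesis
    using assms by (simp add: divide_simps split: if_splits)
qed

lemma exp_minus_lipschitz:
  fixes a b :: real
  assumes "0 \<le> a" "0 \<le> b"
  shows "\<bar>exp (- a) - exp (- b)\<bar> \<le> \<bar>a - b\<bar>"
proof -
  have *: "exp (- x) - exp (- y) \<le> y - x" if "0 \<le> x" "x \<le> y" for x y :: real
  proof -
    define d where "d = y - x"
    have "exp (- x) - exp (- y) = exp (- x) * (1 - exp (- d))"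
      by (simp add: d_def right_diff_distrib flip: exp_add)
    also have "\<dots> \<le> 1 * (1 - exp (- d))"
      using that by (intro mult_right_mono) (auto simp: d_def)
    also have "\<dots> \<le> y - x"
    proof -
      have "1 - d \<le> exp (- d)"
        using exp_ge_add_one_self[of "- d"] by simp
      then show ?thesis
        by (simp add: d_def)
    qed
    finally show ?thesis .
  qed
  show ?thesis
  proof (cases "a \<le> b")
    case True
    then show ?thesis using *[OF assms(1) True] by simp
  next
    case False
    then show ?thesis using *[OF assms(2), of a] by simp
  qed
qed

section \<open>Error bounds for a fixed sample size\<close>

context rotsym_sample
begin

abbreviation "\<sigma> \<equiv> sigma_n M n p (X 1)"

definition scale :: real where
  "scale = sqrt (2 * real p) / (n * \<sigma>)"

definition center :: real where
  "center = (real n - 1) * e1"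

lemma sigma_squared: "\<sigma>\<^sup>2 = real p * e2\<^sup>2 + 2 * real n * real p * e1\<^sup>2 * e2 + f2\<^sup>2"
  using e2_nonneg by (simp add: sigma_n_def)

text \<open>The centred component is bounded by 2. The inequality serves the degenerate case, where
  it makes the fourth moment vanish together with the second.\<close>

lemma e4_le_e2: "e4 \<le> 4 * e2"
proof -
  have e1: "\<bar>e1\<bar> \<le> 1"
  proof -
    have "\<bar>expectation (\<lambda>\<omega>. X 1 \<omega> 0)\<bar> \<le> expectation (\<lambda>\<omega>. \<bar>X 1 \<omega> 0\<bar>)"
      by (rule integral_abs_bound)
    also have "\<dots> \<le> expectation (\<lambda>\<omega>. 1)"
      using one_in p_pos X_le_1[OF one_in]
      by (intro integral_mono_AE bounded_rv_integrable bounded_rv_intros AE_I2) auto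
    finally show ?thesis
      by (simp add: e1_eq prob_space)
  qed
  have int: "bounded_rv (\<lambda>\<omega>. X 1 \<omega> 0 - e1)"
    using one_in p_pos by (intro bounded_rv_intros)
  have "e4 \<le> expectation (\<lambda>\<omega>. 4 * (X 1 \<omega> 0 - e1)\<^sup>2)"
    unfolding e_cmom_eq
  proof (rule integral_mono)
    show "integrable M (\<lambda>\<omega>. (X 1 \<omega> 0 - e1) ^ 4)" "integrable M (\<lambda>\<omega>. 4 * (X 1 \<omega> 0 - e1)\<^sup>2)"
      using int by (auto intro!: bounded_rv_integrable bounded_rv_power bounded_rv_mult bounded_rv_const)
    fix \<omega> assume "\<omega> \<in> space M"
    then have "\<bar>X 1 \<omega> 0\<bar> \<le> 1"
      using X_le_1[OF one_in] p_pos by simp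
    then have "\<bar>X 1 \<omega> 0 - e1\<bar> \<le> 2"
      using e1 by linarith
    then have "(X 1 \<omega> 0 - e1)\<^sup>2 \<le> 2\<^sup>2"
      by (metis abs_le_square_iff abs_numeral)
    then have "(X 1 \<omega> 0 - e1)\<^sup>2 * (X 1 \<omega> 0 - e1)\<^sup>2 \<le> 4 * (X 1 \<omega> 0 - e1)\<^sup>2"
      by (intro mult_right_mono) auto
    then show "(X 1 \<omega> 0 - e1) ^ 4 \<le> 4 * (X 1 \<omega> 0 - e1)\<^sup>2"
      by (simp flip: power_add)
  qed
  then show ?thesis
    by (simp add: e_cmom_eq)
qed

lemma f4_le_f2: "f4 \<le> f2"
  unfolding f4_eq f2_eq
proof (rule integral_mono)
  show "integrable M (\<lambda>\<omega>. (1 - (X 1 \<omega> 0)\<^sup>2)\<^sup>2)" "integrable M (\<lambda>\<omega>. 1 - (X 1 \<omega> 0)\<^sup>2)"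
    using one_in p_pos by (intro bounded_rv_integrable bounded_rv_intros; simp)+
  fix \<omega> assume "\<omega> \<in> space M"
  then have "(X 1 \<omega> 0)\<^sup>2 \<le> 1"
    using X_le_1[OF one_in] p_pos by (simp add: abs_square_le_1)
  then have "(1 - (X 1 \<omega> 0)\<^sup>2) * (1 - (X 1 \<omega> 0)\<^sup>2) \<le> 1 * (1 - (X 1 \<omega> 0)\<^sup>2)"
    by (intro mult_right_mono) auto
  then show "(1 - (X 1 \<omega> 0)\<^sup>2)\<^sup>2 \<le> 1 - (X 1 \<omega> 0)\<^sup>2"
    by (simp add: power2_eq_square)
qed

lemma e4_nonneg: "0 \<le> e4"
  unfolding e_cmom_eq by simp

text \<open>A quotient by \<open>e2\<^sup>2 = 0\<close> is 0 in HOL; the identity survives because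
  \<open>e4\<close> is then 0 too. It lets the ratio in (ii) be used without excluding a degenerate
  component along \<theta>.\<close>

lemma e4_eq_ratio: "e4 = e4 / e2\<^sup>2 / n * (n * e2\<^sup>2)"
  using e4_le_e2 e4_nonneg n_pos by (cases "e2 = 0") auto

lemma f4_eq_ratio: "f4 = f4 / f2\<^sup>2 / n * (n * f2\<^sup>2)"
  using f4_le_f2 f4_nonneg n_pos by (cases "f2 = 0") auto

text \<open>A small first ratio compares \<open>p * e2\<^sup>2\<close> with
  \<open>f2\<^sup>2\<close>; a small second one, multiplied by \<open>p * e2\<close>, compares it
  with half of the middle summand. Either way it is at most \<epsilon> times another part of
  \<open>\<sigma>\<^sup>2\<close>.\<close>

lemma quad_weight_le:
  assumes \<sigma>: "0 < \<sigma>"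
    and small: "min (ereal (real p * e2\<^sup>2) / ereal (f2\<^sup>2)) (ereal e2 / ereal (real n * e1\<^sup>2)) < ereal \<epsilon>"
    and \<epsilon>: "0 < \<epsilon>"
  shows "real p * e2\<^sup>2 / \<sigma>\<^sup>2 \<le> \<epsilon>"
proof -
  have terms: "0 \<le> real p * e2\<^sup>2" "0 \<le> 2 * real n * real p * e1\<^sup>2 * e2" "0 \<le> f2\<^sup>2"
    using e2_nonneg by auto
  have "real p * e2\<^sup>2 \<le> \<epsilon> * \<sigma>\<^sup>2"
  proof (cases "ereal (real p * e2\<^sup>2) / ereal (f2\<^sup>2) < ereal \<epsilon>")
    case True
    then have "real p * e2\<^sup>2 \<le> \<epsilon> * f2\<^sup>2"
      by (rule ereal_divide_less_imp_le[OF _ terms(1,3)])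
    also have "\<dots> \<le> \<epsilon> * \<sigma>\<^sup>2"
      unfolding sigma_squared using terms \<epsilon> by (intro mult_left_mono) linarith+
    finally show ?thesis .
  next
    case False
    with small have "ereal e2 / ereal (real n * e1\<^sup>2) < ereal \<epsilon>"
      by (simp only: min_less_iff_disj) blast
    then have "e2 \<le> \<epsilon> * (real n * e1\<^sup>2)"
      by (rule ereal_divide_less_imp_le[OF _ e2_nonneg]) simp
    then have "real p * e2 * e2 \<le> real p * e2 * (\<epsilon> * (real n * e1\<^sup>2))"
      using e2_nonneg by (intro mult_left_mono) auto
    also have "\<dots> = \<epsilon> * (2 * real n * real p * e1\<^sup>2 * e2 / 2)"
      by (simp add: mult_ac)
    also have "\<dots> \<le> \<epsilon> * \<sigma>\<^sup>2"
      unfolding sigma_squared using terms \<epsilon> by (intro mult_left_mono) linarith+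
    finally show ?thesis
      by (simp add: power2_eq_square mult.assoc)
  qed
  then show ?thesis
    using \<sigma> by (simp add: pos_divide_le_eq)
qed

context
  assumes sigma_pos: "0 < \<sigma>" and p_gt: "1 < p"
begin

text \<open>The shares of \<open>\<sigma>\<^sup>2\<close> due to the quadratic part, the linear part
  (\<open>wy\<close>) and the orthogonal part (\<open>wz\<close>).\<close>

definition wx :: real where "wx = real p * e2\<^sup>2 / \<sigma>\<^sup>2"
definition wy :: real where "wy = 2 * real n * real p * e1\<^sup>2 * e2 / \<sigma>\<^sup>2"
definition wz :: real where "wz = f2\<^sup>2 / \<sigma>\<^sup>2"

lemma weights: "0 \<le> wx" "0 \<le> wy" "0 \<le> wz" "wx + wy + wz = 1"
proof -
  show "0 \<le> wx" "0 \<le> wy" "0 \<le> wz"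
    using e2_nonneg by (simp_all add: wx_def wy_def wz_def)
  show "wx + wy + wz = 1"
    using sigma_pos
    by (simp only: wx_def wy_def wz_def add_divide_distrib[symmetric] sigma_squared[symmetric]) simp
qed

lemma scale_squared: "scale\<^sup>2 = 2 * real p / ((real n)\<^sup>2 * \<sigma>\<^sup>2)"
  by (simp add: scale_def power_divide power_mult_distrib)

lemma n_p_real: "0 < real n" "1 < real p"
  using n_pos p_gt by auto

lemma sum_mean_var:
  "(\<Sum>j<n. mean_var scale center j) = wy * (1 - 1 / n)\<^sup>2 + wz * (1 + 1 / (real p - 1)) * (1 - 1 / n)"
proof -
  have gauss: "(\<Sum>j<n. real j) = real n * (real n - 1) / 2"
    by (induction n) (auto simp: field_simps)
  have "(\<Sum>j<n. mean_var scale center j) = real n * (scale\<^sup>2 * (center\<^sup>2 * e2)) + scale\<^sup>2 * (f2\<^sup>2 / (real p - 1)) * (\<Sum>j<n. real j)"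
  proof -
    have "mean_var scale center j = scale\<^sup>2 * (center\<^sup>2 * e2) + scale\<^sup>2 * (f2\<^sup>2 / (real p - 1)) * real j" for j
      by (simp add: mean_var_def distrib_left power2_eq_square[of f2])
    then show ?thesis
      by (simp only: sum.distrib sum_distrib_left) simp
  qed
  also have "real n * (scale\<^sup>2 * (center\<^sup>2 * e2)) = wy * ((real n - 1) / n)\<^sup>2"
    using n_p_real sigma_pos unfolding scale_squared center_def wy_def
    by (simp add: power_mult_distrib power_divide) (simp add: power2_eq_square mult_ac)
  also have "scale\<^sup>2 * (f2\<^sup>2 / (real p - 1)) * (\<Sum>j<n. real j) = wz * (real p / (real p - 1)) * ((real n - 1) / n)"
    using n_p_real sigma_pos unfolding gauss scale_squared wz_def
    by (simp add: power2_eq_square mult_ac)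
  also have "(real n - 1) / n = 1 - 1 / n"
    using n_p_real by (simp add: field_simps)
  also have "real p / (real p - 1) = 1 + 1 / (real p - 1)"
    using n_p_real by (simp add: field_simps)
  finally show ?thesis .
qed

text \<open>The martingale carries the shares \<open>wy\<close> and \<open>wz\<close> only, so
  \<open>wx\<close> is missing from 1. Replacing \<open>n - 1\<close> by n costs
  \<open>2 / n\<close> in the linear and \<open>1 / n\<close> in the orthogonal part, and
  \<open>p / (p - 1)\<close> accounts for the last term.\<close>

lemma sum_mean_var_near_1:
  "\<bar>(\<Sum>j<n. mean_var scale center j) - 1\<bar> \<le> wx + 3 / n + 1 / (real p - 1)"
proof -
  define v where "v = 1 / real n"
  define u where "u = 1 / (real p - 1)"
  have v: "0 \<le> v" "v \<le> 1" and u: "0 \<le> u"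
    using n_p_real n_pos by (auto simp: v_def u_def)
  have wyz: "wy \<le> 1" "wz \<le> 1"
    using weights by linarith+
  have "(\<Sum>j<n. mean_var scale center j) - 1 = wz * (u * (1 - v)) - (wx + wy * (v * (2 - v)) + wz * v)"
  proof -
    have "(\<Sum>j<n. mean_var scale center j) - 1 = wy * (1 - v)\<^sup>2 + wz * (1 + u) * (1 - v) - (wx + wy + wz)"
      unfolding weights(4) by (simp only: sum_mean_var u_def v_def)
    then show ?thesis
      by (simp add: power2_eq_square algebra_simps)
  qed
  moreover have "0 \<le> wz * (u * (1 - v))" "wz * (u * (1 - v)) \<le> 1 * (u * 1)"
    using weights wyz u v by (simp, intro mult_mono) auto
  moreover have "0 \<le> wy * (v * (2 - v))" "wy * (v * (2 - v)) \<le> 1 * (v * 2)"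
    using weights wyz v by (simp, intro mult_mono) auto
  moreover have "0 \<le> wz * v" "wz * v \<le> 1 * v"
    using weights wyz v by (simp, intro mult_right_mono) auto
  ultimately have "\<bar>(\<Sum>j<n. mean_var scale center j) - 1\<bar> \<le> wx + 3 * v + u"
    using weights(1) by linarith
  then show ?thesis
    by (simp add: u_def v_def)
qed

lemma quad_negligible: "expectation (\<lambda>\<omega>. (scale * quad n \<omega>)\<^sup>2) \<le> wx"
proof -
  have "expectation (\<lambda>\<omega>. (scale * quad n \<omega>)\<^sup>2) = scale\<^sup>2 * (real n * (real n - 1) / 2 * e2\<^sup>2)"
    using expectation_quad_squared[OF p_gt, of n] by (simp add: power_mult_distrib)
  also have "\<dots> = wx * (1 - 1 / n)"
    using n_p_real sigma_pos unfolding scale_squared wx_def by (simp add: field_simps power2_eq_square)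
  also have "\<dots> \<le> wx * 1"
    using n_p_real weights(1) by (intro mult_left_mono) auto
  finally show ?thesis by simp
qed

text \<open>The powers of n and p cancel against the weights: the linear part is at most
  \<open>8 * d1 * wy\<^sup>2\<close>, and the orthogonal part has the constant 96 = 8 * 4 * 3,
  doubled by \<open>p\<^sup>2 / ((p - 1) * (p + 1)) \<le> 2\<close>.\<close>

lemma fourth_moment_bound:
  assumes d: "e4 = d1 * (n * e2\<^sup>2)" "f4 = d2 * (n * f2\<^sup>2)" "0 \<le> d1" "0 \<le> d2"
  shows "n * (8 * scale ^ 4 * (center ^ 4 * e4 + 3 * f4 / ((real p - 1) * (real p + 1)) * (n * f4 + 3 * (real n)\<^sup>2 * f2\<^sup>2)))
    \<le> 8 * d1 + 192 * d2 * (d2 + 3)"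
proof -
  have wyz: "wy \<le> 1" "wz \<le> 1"
    using weights by linarith+
  have scale4: "scale ^ 4 = 4 * (real p)\<^sup>2 / ((real n) ^ 4 * \<sigma> ^ 4)"
  proof -
    have "scale ^ 4 = (scale\<^sup>2)\<^sup>2"
      by (simp flip: power_mult)
    then show ?thesis
      by (simp add: scale_squared power_divide power_mult_distrib flip: power_mult)
  qed
  have 1: "n * (8 * scale ^ 4 * (center ^ 4 * e4)) = 8 * d1 * (wy\<^sup>2 * ((real n - 1) / n) ^ 4)"
    using n_p_real sigma_pos unfolding d scale4 center_def wy_def
    by (simp add: power_mult_distrib power_divide field_simps power2_eq_square power4_eq_xxxx)
  also have "\<dots> \<le> 8 * d1 * (1 * 1)"
    using d n_p_real n_pos wyz weights
    by (intro mult_left_mono mult_mono) (auto simp: power_le_one_iff intro!: power_le_one)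
  finally have A: "n * (8 * scale ^ 4 * (center ^ 4 * e4)) \<le> 8 * d1" by simp
  have 2: "n * (8 * scale ^ 4 * (3 * f4 / ((real p - 1) * (real p + 1)) * (n * f4 + 3 * (real n)\<^sup>2 * f2\<^sup>2)))
    = 96 * d2 * (d2 + 3) * (wz\<^sup>2 * ((real p)\<^sup>2 / ((real p - 1) * (real p + 1))))"
  proof -
    have "N * (8 * (4 * P\<^sup>2 / (N ^ 4 * s ^ 4)) * (3 * (d2 * (N * y)) / D * (N * (d2 * (N * y)) + 3 * N\<^sup>2 * y)))
      = 96 * d2 * (d2 + 3) * ((y / s\<^sup>2)\<^sup>2 * (P\<^sup>2 / D))" if "N \<noteq> 0" "s \<noteq> 0" "D \<noteq> 0" for N P s D y :: real
      using that by (simp add: field_simps power2_eq_square power4_eq_xxxx)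
    then show ?thesis
      using n_p_real sigma_pos unfolding d scale4 wz_def by simp
  qed
  have p2: "(real p)\<^sup>2 / ((real p - 1) * (real p + 1)) \<le> 2"
  proof -
    have "2 \<le> real p"
      using p_gt by simp
    then have "2 * 2 \<le> real p * real p"
      by (intro mult_mono) auto
    then have "(real p)\<^sup>2 \<le> 2 * ((real p - 1) * (real p + 1))"
      by (simp add: power2_eq_square algebra_simps)
    then show ?thesis
      using n_p_real by (simp add: pos_divide_le_eq)
  qed
  have "96 * d2 * (d2 + 3) * (wz\<^sup>2 * ((real p)\<^sup>2 / ((real p - 1) * (real p + 1)))) \<le> 96 * d2 * (d2 + 3) * (1 * 2)"
    using d n_p_real wyz weights p2
    by (intro mult_left_mono mult_mono) (auto intro!: power_le_one)
  then have B: "n * (8 * scale ^ 4 * (3 * f4 / ((real p - 1) * (real p + 1)) * (n * f4 + 3 * (real n)\<^sup>2 * f2\<^sup>2))) \<le> 192 * d2 * (d2 + 3)"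
    unfolding 2 by simp
  show ?thesis
    using A B by (simp only: distrib_left)
qed

lemma conditional_variance_bound:
  assumes d: "f4 = d2 * (n * f2\<^sup>2)" "0 \<le> d2"
  shows "n * (scale\<^sup>2 * (f2 / (real p - 1)) * sqrt (n * f4 + 2 * (real n)\<^sup>2 * f2\<^sup>2 / (real p - 1)))
    \<le> 4 * sqrt (d2 + 2 / (real p - 1))"
proof -
  have wz: "wz \<le> 1"
    using weights by linarith
  have "n * f4 + 2 * (real n)\<^sup>2 * f2\<^sup>2 / (real p - 1) = (n * f2)\<^sup>2 * (d2 + 2 / (real p - 1))"
    unfolding d by (simp add: power2_eq_square algebra_simps)
  then have "sqrt (n * f4 + 2 * (real n)\<^sup>2 * f2\<^sup>2 / (real p - 1)) = (n * f2) * sqrt (d2 + 2 / (real p - 1))"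
    using f2_nonneg by (simp add: real_sqrt_mult)
  then have "n * (scale\<^sup>2 * (f2 / (real p - 1)) * sqrt (n * f4 + 2 * (real n)\<^sup>2 * f2\<^sup>2 / (real p - 1)))
    = 2 * (wz * (real p / (real p - 1))) * sqrt (d2 + 2 / (real p - 1))"
    using n_p_real sigma_pos unfolding scale_squared wz_def
    by (simp add: power2_eq_square mult_ac)
  also have "\<dots> \<le> 2 * (1 * 2) * sqrt (d2 + 2 / (real p - 1))"
  proof -
    have "real p / (real p - 1) \<le> 2"
      using p_gt by (simp add: pos_divide_le_eq)
    then show ?thesis
      using wz weights n_p_real d by (intro mult_right_mono mult_left_mono mult_mono) auto
  qed
  finally show ?thesis by simp
qed

text \<open>The terms come, in order, from discarding the quadratic part, the cubic Taylor
  remainders, the fluctuation of the conditional variances, the second-order error of the Gaussian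
  factors, and the distance of the total variance from 1. The ratios \<open>d1\<close> and
  \<open>d2\<close> enter through products, so zero moments need no separate treatment.\<close>

lemma char_statistic_bound:
  assumes d: "e4 = d1 * (n * e2\<^sup>2)" "f4 = d2 * (n * f2\<^sup>2)" "0 \<le> d1" "0 \<le> d2" and r: "0 < r"
  defines "\<delta> \<equiv> wx + 3 / n + 1 / (real p - 1)" and "\<Lambda> \<equiv> 8 * d1 + 192 * d2 * (d2 + 3)"
  shows "cmod ((CLINT \<omega>|M. iexp (t * (scale * pair_sum \<omega>))) - complex_of_real (exp (- (t\<^sup>2) / 2)))
    \<le> \<bar>t\<bar> * sqrt wx + \<bar>t\<bar> ^ 3 / 12 * (r * (1 + \<delta>) + \<Lambda> / r) + 2 * t\<^sup>2 * sqrt (d2 + 2 / (real p - 1))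
      + t ^ 4 / 8 * \<Lambda> + t\<^sup>2 / 2 * \<delta>"
proof -
  define V where "V = (\<Sum>j<n. mean_var scale center j)"
  define L where "L = 8 * scale ^ 4 * (center ^ 4 * e4 + 3 * f4 / ((real p - 1) * (real p + 1)) * (n * f4 + 3 * (real n)\<^sup>2 * f2\<^sup>2))"
  define W where "W = scale\<^sup>2 * (f2 / (real p - 1)) * sqrt (n * f4 + 2 * (real n)\<^sup>2 * f2\<^sup>2 / (real p - 1))"
  have nL: "n * L \<le> \<Lambda>"
    unfolding L_def \<Lambda>_def using d by (rule fourth_moment_bound)
  have nW: "n * W \<le> 4 * sqrt (d2 + 2 / (real p - 1))"
    unfolding W_def using d(2,4) by (rule conditional_variance_bound)
  have V: "\<bar>V - 1\<bar> \<le> \<delta>"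
    unfolding V_def \<delta>_def by (rule sum_mean_var_near_1)
  have V_nonneg: "0 \<le> V"
    unfolding V_def by (intro sum_nonneg mean_var_nonneg p_gt)
  let ?mart = "\<lambda>\<omega>. mart scale center n \<omega>"
  have bm: "bounded_rv ?mart" and bq: "bounded_rv (\<lambda>\<omega>. scale * quad n \<omega>)"
    by (intro bounded_rv_mart order_refl) (intro bounded_rv_mult bounded_rv_const bounded_rv_quad order_refl)
  have "cmod ((CLINT \<omega>|M. iexp (t * (?mart \<omega> + scale * quad n \<omega>))) - (CLINT \<omega>|M. iexp (t * ?mart \<omega>)))
    \<le> \<bar>t\<bar> * sqrt (expectation (\<lambda>\<omega>. (scale * quad n \<omega>)\<^sup>2))"
    by (rule char_perturbation[OF bm bq])
  also have "\<dots> \<le> \<bar>t\<bar> * sqrt wx"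
    by (intro mult_left_mono real_sqrt_le_mono quad_negligible) simp
  also have "(\<lambda>\<omega>. ?mart \<omega> + scale * quad n \<omega>) = (\<lambda>\<omega>. scale * pair_sum \<omega>)"
    by (simp add: pair_sum_decomp center_def add.commute)
  finally have 1: "cmod ((CLINT \<omega>|M. iexp (t * (scale * pair_sum \<omega>))) - (CLINT \<omega>|M. iexp (t * ?mart \<omega>))) \<le> \<bar>t\<bar> * sqrt wx" .
  have "cmod ((CLINT \<omega>|M. iexp (t * ?mart \<omega>)) - complex_of_real (exp (- (t\<^sup>2 / 2 * V))))
    \<le> (\<Sum>j<n. \<bar>t\<bar> ^ 3 / 6 * expectation (\<lambda>\<omega>. \<bar>incr scale center j \<omega>\<bar> ^ 3)
      + t\<^sup>2 / 2 * expectation (\<lambda>\<omega>. \<bar>cond_var scale center j \<omega> - mean_var scale center j\<bar>)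
      + t ^ 4 / 8 * (mean_var scale center j)\<^sup>2)"
    unfolding V_def by (rule char_mart[OF p_gt order_refl])
  also have "\<dots> \<le> (\<Sum>j<n. \<bar>t\<bar> ^ 3 / 6 * ((r * mean_var scale center j + L / r) / 2) + t\<^sup>2 / 2 * W + t ^ 4 / 8 * L)"
  proof (intro sum_mono add_mono mult_left_mono)
    fix j assume "j \<in> {..<n}"
    then have j: "j < n" by simp
    have L: "expectation (\<lambda>\<omega>. incr scale center j \<omega> ^ 4) \<le> L"
      unfolding L_def by (rule expectation_incr_power4_le[OF j p_gt])
    have "expectation (\<lambda>\<omega>. \<bar>incr scale center j \<omega>\<bar> ^ 3) \<le> (r * mean_var scale center j + expectation (\<lambda>\<omega>. incr scale center j \<omega> ^ 4) / r) / 2"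
      by (rule expectation_abs_incr_cube_le[OF j p_gt r])
    also have "\<dots> \<le> (r * mean_var scale center j + L / r) / 2"
      using L r by (intro divide_right_mono add_left_mono) auto
    finally show "expectation (\<lambda>\<omega>. \<bar>incr scale center j \<omega>\<bar> ^ 3) \<le> (r * mean_var scale center j + L / r) / 2" .
    show "expectation (\<lambda>\<omega>. \<bar>cond_var scale center j \<omega> - mean_var scale center j\<bar>) \<le> W"
      unfolding W_def by (rule expectation_abs_cond_var_le[OF j p_gt])
    show "(mean_var scale center j)\<^sup>2 \<le> L"
      using mean_var_squared_le[OF j p_gt] L by (rule order_trans)
  qed auto
  also have "\<dots> = \<bar>t\<bar> ^ 3 / 12 * (r * V + n * L / r) + t\<^sup>2 / 2 * (n * W) + t ^ 4 / 8 * (n * L)"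
    unfolding V_def by (simp add: sum.distrib sum_distrib_left sum_divide_distrib add_divide_distrib distrib_left mult_ac)
  also have "\<dots> \<le> \<bar>t\<bar> ^ 3 / 12 * (r * (1 + \<delta>) + \<Lambda> / r) + t\<^sup>2 / 2 * (4 * sqrt (d2 + 2 / (real p - 1))) + t ^ 4 / 8 * \<Lambda>"
    using V nL nW r by (intro add_mono mult_left_mono divide_right_mono) auto
  finally have 2: "cmod ((CLINT \<omega>|M. iexp (t * ?mart \<omega>)) - complex_of_real (exp (- (t\<^sup>2 / 2 * V))))
    \<le> \<bar>t\<bar> ^ 3 / 12 * (r * (1 + \<delta>) + \<Lambda> / r) + 2 * t\<^sup>2 * sqrt (d2 + 2 / (real p - 1)) + t ^ 4 / 8 * \<Lambda>"
    by simp
  have "cmod (complex_of_real (exp (- (t\<^sup>2 / 2 * V))) - complex_of_real (exp (- (t\<^sup>2 / 2))))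
    = \<bar>exp (- (t\<^sup>2 / 2 * V)) - exp (- (t\<^sup>2 / 2))\<bar>"
    by (simp only: norm_of_real flip: of_real_diff)
  also have "\<dots> \<le> \<bar>t\<^sup>2 / 2 * V - t\<^sup>2 / 2\<bar>"
    using V_nonneg by (intro exp_minus_lipschitz) auto
  also have "\<dots> = t\<^sup>2 / 2 * \<bar>V - 1\<bar>"
  proof -
    have "t\<^sup>2 / 2 * V - t\<^sup>2 / 2 = t\<^sup>2 / 2 * (V - 1)"
      by (simp add: right_diff_distrib)
    then show ?thesis
      by (simp only: abs_mult) simp
  qed
  also have "\<dots> \<le> t\<^sup>2 / 2 * \<delta>"
    using V by (intro mult_left_mono) auto
  finally have 3: "cmod (complex_of_real (exp (- (t\<^sup>2 / 2 * V))) - complex_of_real (exp (- (t\<^sup>2) / 2))) \<le> t\<^sup>2 / 2 * \<delta>"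
    by simp
  show ?thesis
    using norm_triangle_le[OF add_mono[OF norm_triangle_le[OF add_mono[OF 1 2]] 3]] by simp
qed

end

end

section \<open>Passage to the limit\<close>

lemma weak_conv_m_Suc_iff: "weak_conv_m (\<lambda>n. \<mu> (Suc n)) \<nu> \<longleftrightarrow> weak_conv_m \<mu> \<nu>"
  unfolding weak_conv_m_def weak_conv_def
  using filterlim_sequentially_Suc[where f = "\<lambda>n. cdf (\<mu> n) _"] by blast

text \<open>
  The index 0 carries no hypothesis, and there the law need not be a probability measure; Levy's
  theorem is therefore applied to the shifted sequence.
\<close>

theorem theorem5p1:
  fixes p :: "nat \<Rightarrow> nat"
    and F :: "nat \<Rightarrow> real \<Rightarrow> real"
    and M :: "nat \<Rightarrow> 'a measure"
    and X :: "nat \<Rightarrow> nat \<Rightarrow> 'a \<Rightarrow> nat \<Rightarrow> real"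
  assumes p_pos: "\<forall>n\<ge>1. p n > 0"
    and p_lim: "filterlim p at_top sequentially"
    and hyp: "\<forall>n\<ge>1. rotsym_hypothesis (M n) n (p n) (F n) (X n)"
    and nondegenerate: "\<forall>\<^sub>F n in sequentially. sigma_n (M n) n (p n) (X n 1) > 0"
    and cond_i: "(\<lambda>n. min
        (ereal (real (p n) * (e_cmom (M n) (p n) (X n 1) 2)\<^sup>2)
          / ereal ((f_mom (M n) (p n) (X n 1) 2)\<^sup>2))
        (ereal (e_cmom (M n) (p n) (X n 1) 2)
          / ereal (real n * (e_mom (M n) (p n) (X n 1) 1)\<^sup>2))) \<longlonglongrightarrow> 0"
    and cond_ii: "(\<lambda>n. e_cmom (M n) (p n) (X n 1) 4 / (e_cmom (M n) (p n) (X n 1) 2)\<^sup>2)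
        \<in> o(\<lambda>n. real n)"
    and cond_iii: "(\<lambda>n. f_mom (M n) (p n) (X n 1) 4 / (f_mom (M n) (p n) (X n 1) 2)\<^sup>2)
        \<in> o(\<lambda>n. real n)"
  shows "(\<forall>n\<ge>1. \<forall>\<omega>\<in>space (M n).
      (rayleigh_st n (p n) (X n) \<omega> - (\<integral>\<omega>'. rayleigh_st n (p n) (X n) \<omega>' \<partial>M n))
          / sigma_n (M n) n (p n) (X n 1)
      = sqrt (2 * real (p n)) / (real n * sigma_n (M n) n (p n) (X n 1))
          * (\<Sum>j=1..n. \<Sum>i=1..<j. (vec_inner (p n) (X n i \<omega>) (X n j \<omega>)
               - (e_mom (M n) (p n) (X n 1) 1)\<^sup>2))) \<and>
    weak_conv_m
      (\<lambda>n. distr (M n) borel (\<lambda>\<omega>.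
        (rayleigh_st n (p n) (X n) \<omega> - (\<integral>\<omega>'. rayleigh_st n (p n) (X n) \<omega>' \<partial>M n))
          / sigma_n (M n) n (p n) (X n 1)))
      std_normal_distribution"
proof -
  let ?stat = "\<lambda>n \<omega>. (rayleigh_st n (p n) (X n) \<omega> - (\<integral>\<omega>'. rayleigh_st n (p n) (X n) \<omega>' \<partial>M n))
          / sigma_n (M n) n (p n) (X n 1)"
  let ?\<sigma> = "\<lambda>n. sigma_n (M n) n (p n) (X n 1)"
  let ?\<mu> = "\<lambda>n. distr (M n) borel (?stat n)"
  have loc: "rotsym_sample (M n) n (p n) (F n) (X n)" if "1 \<le> n" for n
  proof (intro rotsym_sample.intro rotsym_sample_axioms.intro)
    show rotsym: "rotsym_hypothesis (M n) n (p n) (F n) (X n)"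
      using hyp that by blast
    then show "prob_space (M n)"
      unfolding rotsym_hypothesis_def by blast
    show "1 \<le> n" "0 < p n"
      using that p_pos by blast+
  qed
  define S where "S n \<omega> = rotsym_sample.scale (M n) n (p n) (X n) * rotsym_sample.pair_sum (M n) n (p n) (X n) \<omega>" for n \<omega>
  have stat_eq: "?stat n \<omega> = S n \<omega>" if n: "1 \<le> n" and \<omega>: "\<omega> \<in> space (M n)" for n \<omega>
  proof -
    interpret rotsym_sample "M n" n "p n" "F n" "X n" by (rule loc[OF n])
    show ?thesis
      using rayleigh_st_centered[OF \<omega>] by (simp add: S_def scale_def)
  qed
  have S_eq: "S n \<omega> = sqrt (2 * real (p n)) / (real n * ?\<sigma> n)
      * (\<Sum>j=1..n. \<Sum>i=1..<j. (vec_inner (p n) (X n i \<omega>) (X n j \<omega>) - (e_mom (M n) (p n) (X n 1) 1)\<^sup>2))" if n: "1 \<le> n" for n \<omega>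
  proof -
    interpret rotsym_sample "M n" n "p n" "F n" "X n" by (rule loc[OF n])
    show ?thesis
      by (simp add: S_def scale_def pair_sum_def)
  qed
  have S_measurable: "S n \<in> borel_measurable (M n)" if n: "1 \<le> n" for n
  proof -
    interpret rotsym_sample "M n" n "p n" "F n" "X n" by (rule loc[OF n])
    show ?thesis
      unfolding S_def[abs_def] using bounded_rv_measurable[OF bounded_rv_pair_sum] by measurable
  qed
  have \<mu>_eq: "?\<mu> n = distr (M n) borel (S n)" if "1 \<le> n" for n
    using stat_eq[OF that] by (intro distr_cong) auto
  have real_distr: "real_distribution (?\<mu> n)" if n: "1 \<le> n" for n
  proof -
    interpret rotsym_sample "M n" n "p n" "F n" "X n" by (rule loc[OF n])
    show ?thesis
      unfolding \<mu>_eq[OF n] using S_measurable[OF n] by (rule real_distribution_distr)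
  qed
  define x where "x n = real (p n) * (e_cmom (M n) (p n) (X n 1) 2)\<^sup>2 / (?\<sigma> n)\<^sup>2" for n
  define d1 where "d1 n = e_cmom (M n) (p n) (X n 1) 4 / (e_cmom (M n) (p n) (X n 1) 2)\<^sup>2 / real n" for n
  define d2 where "d2 n = f_mom (M n) (p n) (X n 1) 4 / (f_mom (M n) (p n) (X n 1) 2)\<^sup>2 / real n" for n
  define \<delta> where "\<delta> n = x n + 3 / real n + 1 / (real (p n) - 1)" for n
  define \<Lambda> where "\<Lambda> n = 8 * d1 n + 192 * d2 n * (d2 n + 3)" for n
  \<comment> \<open>This weight tends to 0 while still \<open>\<Lambda> n / r n \<le> r n\<close>,
    which balances the two cubic error terms. The summand \<open>1 / real n\<close> keeps it
    positive when \<open>\<Lambda> n\<close> is 0.\<close>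
  define r where "r n = sqrt (\<Lambda> n + 1 / real n)" for n
  have ge_1: "\<forall>\<^sub>F n in sequentially. (1 :: nat) \<le> n"
    by (rule eventually_ge_at_top)
  have d1_lim: "d1 \<longlonglongrightarrow> 0" and d2_lim: "d2 \<longlonglongrightarrow> 0"
    unfolding d1_def[abs_def] d2_def[abs_def] using cond_ii cond_iii by (auto dest: smalloD_tendsto)
  have x_lim: "x \<longlonglongrightarrow> 0"
  proof (rule tendstoI)
    fix \<epsilon> :: real assume \<epsilon>: "0 < \<epsilon>"
    \<comment> \<open>Half of \<epsilon> is used since the bound on the weight is not strict,
      whereas convergence asks for a strict one.\<close>
    have "\<forall>\<^sub>F n in sequentially. min
        (ereal (real (p n) * (e_cmom (M n) (p n) (X n 1) 2)\<^sup>2)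
          / ereal ((f_mom (M n) (p n) (X n 1) 2)\<^sup>2))
        (ereal (e_cmom (M n) (p n) (X n 1) 2)
          / ereal (real n * (e_mom (M n) (p n) (X n 1) 1)\<^sup>2)) < ereal (\<epsilon> / 2)"
      using \<epsilon> by (intro order_tendstoD(2)[OF cond_i]) (simp add: zero_ereal_def)
    then show "\<forall>\<^sub>F n in sequentially. dist (x n) 0 < \<epsilon>"
      using ge_1 nondegenerate
    proof eventually_elim
      case (elim n)
      interpret rotsym_sample "M n" n "p n" "F n" "X n" using elim(2) by (rule loc)
      have "x n \<le> \<epsilon> / 2"
        unfolding x_def using elim \<epsilon> by (intro quad_weight_le) auto
      moreover have "0 \<le> x n"
        by (simp add: x_def)
      ultimately show ?case
        using \<epsilon> by simp
    qed
  qed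
  have inv_n: "(\<lambda>n. 1 / real n) \<longlonglongrightarrow> 0"
    by (rule lim_1_over_n)
  have p_real: "filterlim (\<lambda>n. real (p n) - 1) at_top sequentially"
    using filterlim_tendsto_add_at_top[OF tendsto_const[of "-1"] filterlim_compose[OF filterlim_real_sequentially p_lim]]
    by simp
  have inv_p: "(\<lambda>n. c / (real (p n) - 1)) \<longlonglongrightarrow> 0" for c :: real
    by (rule real_tendsto_divide_at_top[OF tendsto_const p_real])
  have \<delta>_lim: "\<delta> \<longlonglongrightarrow> 0"
    unfolding \<delta>_def[abs_def]
    using tendsto_add[OF tendsto_add[OF x_lim tendsto_mult_right_zero[OF inv_n, of 3]] inv_p[of 1]] by simp
  have \<Lambda>_lim: "\<Lambda> \<longlonglongrightarrow> 0"
    unfolding \<Lambda>_def[abs_def] using d1_lim d2_lim by (auto intro!: tendsto_eq_intros)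
  have r_lim: "r \<longlonglongrightarrow> 0"
    unfolding r_def[abs_def] using tendsto_real_sqrt[OF tendsto_add[OF \<Lambda>_lim inv_n]] by simp
  have char_lim: "(\<lambda>n. char (?\<mu> n) t) \<longlonglongrightarrow> char std_normal_distribution t" for t
  proof -
    define bound where "bound n = \<bar>t\<bar> * sqrt (x n) + \<bar>t\<bar> ^ 3 / 12 * (r n * (1 + \<delta> n) + r n)
      + 2 * t\<^sup>2 * sqrt (d2 n + 2 / (real (p n) - 1)) + t ^ 4 / 8 * \<Lambda> n + t\<^sup>2 / 2 * \<delta> n" for n
    have "bound \<longlonglongrightarrow> \<bar>t\<bar> * sqrt 0 + \<bar>t\<bar> ^ 3 / 12 * (0 * (1 + 0) + 0) + 2 * t\<^sup>2 * sqrt (0 + 0) + t ^ 4 / 8 * 0 + t\<^sup>2 / 2 * 0"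
      unfolding bound_def[abs_def] by (intro tendsto_intros x_lim r_lim \<delta>_lim d2_lim inv_p \<Lambda>_lim)
    then have bound_lim: "bound \<longlonglongrightarrow> 0"
      by simp
    have p_ev: "\<forall>\<^sub>F n in sequentially. 1 < p n"
      by (rule eventually_compose_filterlim[OF eventually_gt_at_top p_lim])
    have "\<forall>\<^sub>F n in sequentially. norm (char (?\<mu> n) t - char std_normal_distribution t) \<le> bound n"
      using ge_1 nondegenerate p_ev
    proof eventually_elim
      case (elim n)
      interpret rotsym_sample "M n" n "p n" "F n" "X n" using elim(1) by (rule loc)
      have d: "e4 = d1 n * (n * e2\<^sup>2)" "f4 = d2 n * (n * f2\<^sup>2)"
        using e4_eq_ratio f4_eq_ratio by (simp_all only: d1_def d2_def)
      have d_nonneg: "0 \<le> d1 n" "0 \<le> d2 n"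
        using e4_nonneg f4_nonneg by (simp_all add: d1_def d2_def)
      have \<Lambda>: "0 \<le> \<Lambda> n"
        using d_nonneg by (simp add: \<Lambda>_def)
      then have r: "0 < r n"
        using elim(1) by (simp add: r_def add_nonneg_pos)
      have "\<Lambda> n \<le> r n * r n"
        using \<Lambda> by (simp add: r_def)
      then have \<Lambda>_r: "\<Lambda> n / r n \<le> r n"
        using r by (simp add: pos_divide_le_eq)
      have char_\<mu>: "char (?\<mu> n) t = (CLINT \<omega>|M n. iexp (t * S n \<omega>))"
        unfolding \<mu>_eq[OF elim(1)] char_def using S_measurable[OF elim(1)] by (subst integral_distr) auto
      have "cmod ((CLINT \<omega>|M n. iexp (t * S n \<omega>)) - complex_of_real (exp (- (t\<^sup>2) / 2)))
        \<le> \<bar>t\<bar> * sqrt (x n) + \<bar>t\<bar> ^ 3 / 12 * (r n * (1 + \<delta> n) + \<Lambda> n / r n)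
          + 2 * t\<^sup>2 * sqrt (d2 n + 2 / (real (p n) - 1)) + t ^ 4 / 8 * \<Lambda> n + t\<^sup>2 / 2 * \<delta> n"
        using char_statistic_bound[OF elim(2,3) d d_nonneg r, of t] wx_def[OF elim(2,3)]
        by (simp only: S_def x_def[symmetric] \<delta>_def[symmetric] \<Lambda>_def[symmetric])
      also have "\<dots> \<le> bound n"
        unfolding bound_def using \<Lambda>_r r by (intro add_mono mult_left_mono) auto
      finally show ?case
        by (simp only: char_\<mu> char_std_normal_distribution)
    qed
    then show ?thesis
      using bound_lim by (rule LIM_zero_cancel[OF Lim_null_comparison])
  qed
  have "weak_conv_m (\<lambda>n. ?\<mu> (Suc n)) std_normal_distribution"
  proof (rule levy_continuity)
    show "real_distribution (?\<mu> (Suc n))" for n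
      by (rule real_distr) simp
    show "real_distribution std_normal_distribution"
      by (rule real_dist_normal_dist)
    show "(\<lambda>n. char (?\<mu> (Suc n)) t) \<longlonglongrightarrow> char std_normal_distribution t" for t
      using LIMSEQ_Suc[OF char_lim] .
  qed
  then have "weak_conv_m ?\<mu> std_normal_distribution"
    by (simp only: weak_conv_m_Suc_iff[of ?\<mu>])
  moreover have "?stat n \<omega> = sqrt (2 * real (p n)) / (real n * ?\<sigma> n)
      * (\<Sum>j=1..n. \<Sum>i=1..<j. (vec_inner (p n) (X n i \<omega>) (X n j \<omega>) - (e_mom (M n) (p n) (X n 1) 1)\<^sup>2))"
    if "1 \<le> n" "\<omega> \<in> space (M n)" for n \<omega>
    using stat_eq[OF that] S_eq[OF that(1)] by simp
  ultimately show ?thesis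
    by blast
qed

end
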